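(* Let $k$ be a positive integer and let $G$ be a $k$-edge-connected graph. (1) If $k\ge 4$, then $G$ has a spanning closed trail meeting each vertex $v$ at most $f(v)$ times, where $f(v)=\lceil\frac{d_G(v)+k/2-4}{k}\rceil+1$. (2) If $k\le 3$, then $G$ has a spanning closed walk meeting each vertex $v$ at most $f(v)$ times, where $f(v)=\lceil\frac{d_G(v)-1}{k}\rceil+1$.
   Context: Graphs are finite, loopless, and may have multiple edges. A spanning closed trail (resp. walk) is a closed trail (resp. closed walk) passing through every vertex; it meets $v$ at most $f(v)$ times if it passes through $v$ at most $f(v)$ times. $d_G(v)$ is the degree of $v$. *)

theory Defs
  imports Complex_Main
begin

text \<open>Finite loopless graphs with possible multiple edges: edges are objects of their own, and
  \<open>ends G e\<close> is the set of the two end-vertices of \<open>e\<close>.\<close>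

record ('v, 'e) multigraph =
  verts :: "'v set"
  edges :: "'e set"
  ends :: "'e \<Rightarrow> 'v set"

definition finite_multigraph :: "('v, 'e) multigraph \<Rightarrow> bool" where
  "finite_multigraph G \<longleftrightarrow>
     finite (verts G) \<and> finite (edges G) \<and>
     (\<forall>e\<in>edges G. ends G e \<subseteq> verts G \<and> card (ends G e) = 2)"

definition degree :: "('v, 'e) multigraph \<Rightarrow> 'v \<Rightarrow> nat" where
  "degree G v = card {e \<in> edges G. v \<in> ends G e}"

text \<open>A walk \<open>v\<^sub>0 e\<^sub>1 v\<^sub>1 \<dots> e\<^sub>n v\<^sub>n\<close> is given by its first vertex \<open>v\<^sub>0\<close>, the list
  \<open>[(e\<^sub>1, v\<^sub>1), \<dots>, (e\<^sub>n, v\<^sub>n)]\<close> of its steps, and its last vertex \<open>v\<^sub>n\<close>.\<close>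

fun walk :: "('v, 'e) multigraph \<Rightarrow> 'v \<Rightarrow> ('e \<times> 'v) list \<Rightarrow> 'v \<Rightarrow> bool" where
  "walk G u [] v \<longleftrightarrow> u \<in> verts G \<and> u = v"
| "walk G u ((e, w) # p) v \<longleftrightarrow>
     u \<in> verts G \<and> e \<in> edges G \<and> ends G e = {u, w} \<and> walk G w p v"

definition connected_graph :: "('v, 'e) multigraph \<Rightarrow> bool" where
  "connected_graph G \<longleftrightarrow>
     verts G \<noteq> {} \<and> (\<forall>u\<in>verts G. \<forall>v\<in>verts G. \<exists>p. walk G u p v)"

definition delete_edges :: "('v, 'e) multigraph \<Rightarrow> 'e set \<Rightarrow> ('v, 'e) multigraph" where
  "delete_edges G F = G\<lparr>edges := edges G - F\<rparr>"

text \<open>As in Diestel's book, a \<open>k\<close>-edge-connected graph has more than one vertex.\<close>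

definition edge_connected :: "nat \<Rightarrow> ('v, 'e) multigraph \<Rightarrow> bool" where
  "edge_connected k G \<longleftrightarrow>
     card (verts G) > 1 \<and>
     (\<forall>F. F \<subseteq> edges G \<and> card F < k \<longrightarrow> connected_graph (delete_edges G F))"

definition closed_walk :: "('v, 'e) multigraph \<Rightarrow> 'v \<Rightarrow> ('e \<times> 'v) list \<Rightarrow> bool" where
  "closed_walk G u p \<longleftrightarrow> walk G u p u"

definition closed_trail :: "('v, 'e) multigraph \<Rightarrow> 'v \<Rightarrow> ('e \<times> 'v) list \<Rightarrow> bool" where
  "closed_trail G u p \<longleftrightarrow> closed_walk G u p \<and> distinct (map fst p)"

definition spanning :: "('v, 'e) multigraph \<Rightarrow> 'v \<Rightarrow> ('e \<times> 'v) list \<Rightarrow> bool" where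
  "spanning G u p \<longleftrightarrow> verts G \<subseteq> insert u (set (map snd p))"

text \<open>For a closed walk \<open>v\<^sub>0 e\<^sub>1 v\<^sub>1 \<dots> e\<^sub>n v\<^sub>n = v\<^sub>0\<close> this is the number of indices \<open>1 \<le> i \<le> n\<close>
  with \<open>v\<^sub>i = v\<close>, so that the common first and last vertex is one passage, not two.\<close>

definition visits :: "('e \<times> 'v) list \<Rightarrow> 'v \<Rightarrow> nat" where
  "visits p v = count_list (map snd p) v"

end

theory Submission
  imports Defs
begin

text \<open>Call an edge set \<open>m\<close>-sparse if it has at most \<open>m (|X| - 1)\<close> edges inside every nonempty vertex set \<open>X\<close>.
  Suppose \<open>k \<ge> 2m\<close>. Among the \<open>m\<close>-sparse edge sets \<open>H\<close> with \<open>m (|V| - 1)\<close> edges choose one with minimal total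
  excess over the bounds \<open>b(v) = \<lceil>m (d(v) - 2m) / k\<rceil> + 2m\<close>. If the excess is positive, exchanges of edges yield
  a set \<open>S\<close> of vertices of degree at least \<open>b\<close> in \<open>H\<close> such that every edge of \<open>G - S\<close> outside \<open>H\<close> has both
  ends in a common tight set of \<open>H - S\<close>. Counting edges over the partition of \<open>V - S\<close> into maximal tight sets
  then contradicts \<open>k\<close>-edge-connectivity. Hence \<open>H\<close> can be chosen with degrees at most \<open>b\<close>.

  For \<open>m = 2\<close>, \<open>H\<close> contains two edge-disjoint connected spanning subgraphs \<open>A\<close> and \<open>B\<close>, and a \<open>T\<close>-join in \<open>B\<close> for
  the set \<open>T\<close> of vertices of odd degree in \<open>A\<close> makes \<open>A\<close> Eulerian. This settles \<open>k \<ge> 4\<close>. For \<open>k = 2\<close> apply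
  the case \<open>k = 4\<close> to the graph with all edges doubled, and for \<open>k = 3\<close> to the graph obtained from \<open>G\<close> by doubling the
  edges of a \<open>T\<close>-join inside a spanning tree of small degrees (\<open>m = 1\<close>), \<open>T\<close> being the set of vertices of odd degree.
  For \<open>k = 1\<close> an Eulerian trail of the doubled graph suffices.\<close>

section \<open>Sparse and tight edge sets\<close>

definition induced :: "('e \<Rightarrow> 'v set) \<Rightarrow> 'e set \<Rightarrow> 'v set \<Rightarrow> 'e set" where
  "induced d F X = {e \<in> F. d e \<subseteq> X}"

definition boundary :: "('e \<Rightarrow> 'v set) \<Rightarrow> 'e set \<Rightarrow> 'v set \<Rightarrow> 'e set" where
  "boundary d F X = {e \<in> F. d e \<inter> X \<noteq> {} \<and> \<not> d e \<subseteq> X}"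

definition incident :: "('e \<Rightarrow> 'v set) \<Rightarrow> 'e set \<Rightarrow> 'v \<Rightarrow> 'e set" where
  "incident d F v = {e \<in> F. v \<in> d e}"

abbreviation deg :: "('e \<Rightarrow> 'v set) \<Rightarrow> 'e set \<Rightarrow> 'v \<Rightarrow> nat" where
  "deg d F v \<equiv> card (incident d F v)"

text \<open>By Nash-Williams, for edges with two ends in \<open>V\<close> these are the edge sets
  that decompose into \<open>m\<close> forests. The bound is written additively because subtraction
  on \<open>nat\<close> is truncated.\<close>

definition sparse :: "('e \<Rightarrow> 'v set) \<Rightarrow> nat \<Rightarrow> 'v set \<Rightarrow> 'e set \<Rightarrow> bool" where
  "sparse d m V F \<longleftrightarrow> (\<forall>X\<subseteq>V. X \<noteq> {} \<longrightarrow> card (induced d F X) + m \<le> m * card X)"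

definition tight :: "('e \<Rightarrow> 'v set) \<Rightarrow> nat \<Rightarrow> 'e set \<Rightarrow> 'v set \<Rightarrow> bool" where
  "tight d m F X \<longleftrightarrow> X \<noteq> {} \<and> card (induced d F X) + m = m * card X"

text \<open>Connectedness by cuts rather than walks: counting arguments deliver this form, and it
  lets a vertex set grow along a crossing edge.\<close>

definition cut_connected :: "('e \<Rightarrow> 'v set) \<Rightarrow> 'v set \<Rightarrow> 'e set \<Rightarrow> bool" where
  "cut_connected d V F \<longleftrightarrow> (\<forall>X. X \<noteq> {} \<and> X \<subset> V \<longrightarrow> boundary d F X \<noteq> {})"

lemma sparseD: "sparse d m V F \<Longrightarrow> X \<subseteq> V \<Longrightarrow> X \<noteq> {} \<Longrightarrow> card (induced d F X) + m \<le> m * card X"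
  by (simp add: sparse_def)

text \<open>Edges inside \<open>X\<close> or \<open>Y\<close> lie inside the union, those inside
  both lie inside the intersection. Edges inside the union but inside neither set account for the
  slack.\<close>

lemma card_induced_supermodular:
  assumes "finite F"
  shows "card (induced d F X) + card (induced d F Y)
    \<le> card (induced d F (X \<union> Y)) + card (induced d F (X \<inter> Y))"
proof -
  have fin: "finite (induced d F Z)" for Z using assms by (simp add: induced_def)
  have "card (induced d F X) + card (induced d F Y)
      = card (induced d F X \<union> induced d F Y) + card (induced d F X \<inter> induced d F Y)"
    by (rule card_Un_Int[OF fin fin])
  moreover have "card (induced d F X \<union> induced d F Y) \<le> card (induced d F (X \<union> Y))"
    by (rule card_mono[OF fin]) (auto simp: induced_def)
  moreover have "induced d F X \<inter> induced d F Y = induced d F (X \<inter> Y)"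
    by (auto simp: induced_def)
  ultimately show ?thesis by simp
qed

text \<open>The map \<open>d\<close> is a parameter of its own because later arguments move an edge
  to other ends or put two copies of it on the same ends.\<close>

locale mgraph =
  fixes V :: "'v set" and E :: "'e set" and d :: "'e \<Rightarrow> 'v set"
  assumes finV: "finite V" and finE: "finite E"
    and ends_sub: "e \<in> E \<Longrightarrow> d e \<subseteq> V" and ends_card: "e \<in> E \<Longrightarrow> card (d e) = 2"
begin

section \<open>Counting in finite loopless multigraphs\<close>

lemma ends_nonempty: "e \<in> E \<Longrightarrow> d e \<noteq> {}"
  using ends_card by fastforce

lemma fin_sub: "F \<subseteq> E \<Longrightarrow> finite F"
  using finE by (rule rev_finite_subset)

lemma fin_vsub: "X \<subseteq> V \<Longrightarrow> finite X"
  using finV by (rule rev_finite_subset)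

lemma fin_induced: "F \<subseteq> E \<Longrightarrow> finite (induced d F X)"
  using fin_sub by (simp add: induced_def)

lemma induced_V: "F \<subseteq> E \<Longrightarrow> induced d F V = F"
  using ends_sub by (auto simp: induced_def)

lemma induced_singleton:
  assumes "F \<subseteq> E" shows "induced d F {v} = {}"
proof -
  { fix e assume "e \<in> F" "d e \<subseteq> {v}"
    then have "card (d e) \<le> card {v}" by (intro card_mono) auto
    then have False using ends_card \<open>e \<in> F\<close> assms by force }
  then show ?thesis by (auto simp: induced_def)
qed

text \<open>Without loops both sides equal \<open>m\<close>. Hence every vertex lies in some tight
  set, which is where the constructions with tight sets start.\<close>

lemma tight_singleton: "F \<subseteq> E \<Longrightarrow> tight d m F {v}"
  by (simp add: tight_def induced_singleton)

text \<open>Double counting of incidences, with the edges sorted by their number of ends in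
  \<open>X\<close>.\<close>

lemma sum_deg:
  assumes F: "F \<subseteq> E" and X: "X \<subseteq> V"
  shows "(\<Sum>v\<in>X. deg d F v) = 2 * card (induced d F X) + card (boundary d F X)"
proof -
  have finF: "finite F" using F by (rule fin_sub)
  have finX: "finite X" using X by (rule fin_vsub)
  have "(\<Sum>v\<in>X. deg d F v) = (\<Sum>e\<in>F. card {v \<in> X. v \<in> d e})"
    unfolding incident_def by (rule sum_multicount_gen) (use finF finX in auto)
  also have "\<dots> = (\<Sum>e\<in>F. 2 * of_bool (d e \<subseteq> X) + of_bool (d e \<inter> X \<noteq> {} \<and> \<not> d e \<subseteq> X))"
  proof (rule sum.cong[OF refl])
    fix e assume e: "e \<in> F"
    then have "card (d e) = 2" using F ends_card by auto
    then obtain x y where xy: "d e = {x, y}" "x \<noteq> y" by (auto simp: card_2_iff)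
    have eq: "{v \<in> X. v \<in> d e} = (if x \<in> X then {x} else {}) \<union> (if y \<in> X then {y} else {})"
      using xy by auto
    show "card {v \<in> X. v \<in> d e} = 2 * of_bool (d e \<subseteq> X) + of_bool (d e \<inter> X \<noteq> {} \<and> \<not> d e \<subseteq> X)"
      unfolding eq using xy by auto
  qed
  also have "\<dots> = 2 * card (induced d F X) + card (boundary d F X)"
  proof -
    have i1: "(\<Sum>e\<in>F. of_bool (d e \<subseteq> X) :: nat) = card (induced d F X)"
      using finF by (simp add: induced_def Int_def)
    have i2: "(\<Sum>e\<in>F. of_bool (d e \<inter> X \<noteq> {} \<and> \<not> d e \<subseteq> X) :: nat) = card (boundary d F X)"
      using finF by (simp add: boundary_def Int_def)
    show ?thesis unfolding sum.distrib sum_distrib_left[symmetric] i1 i2 ..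
  qed
  finally show ?thesis .
qed

lemma handshake: "F \<subseteq> E \<Longrightarrow> (\<Sum>v\<in>V. deg d F v) = 2 * card F"
proof -
  assume F: "F \<subseteq> E"
  have "boundary d F V = {}" using ends_sub F by (auto simp: boundary_def)
  then show ?thesis using sum_deg[OF F, of V] by (simp add: induced_V F)
qed

text \<open>Uncrossing: \<open>m * card X\<close> is modular and the number of induced edges is
  supermodular, so the sparsity bounds of union and intersection must both be equalities. The sets
  have to meet because sparsity says nothing about the empty set.\<close>

lemma tight_Un_Int:
  assumes F: "F \<subseteq> E" "sparse d m V F" and X: "X \<subseteq> V" "tight d m F X" and Y: "Y \<subseteq> V" "tight d m F Y"
    and XY: "X \<inter> Y \<noteq> {}"
  shows "tight d m F (X \<union> Y)" "tight d m F (X \<inter> Y)"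
proof -
  have "card X + card Y = card (X \<union> Y) + card (X \<inter> Y)"
    using X Y fin_vsub by (intro card_Un_Int) auto
  then have "m * card X + m * card Y = m * card (X \<union> Y) + m * card (X \<inter> Y)"
    by (metis add_mult_distrib2)
  moreover have "card (induced d F (X \<union> Y)) + m \<le> m * card (X \<union> Y)"
    using XY X Y by (intro sparseD[OF F(2)]) auto
  moreover have "card (induced d F (X \<inter> Y)) + m \<le> m * card (X \<inter> Y)"
    using XY X Y by (intro sparseD[OF F(2)]) auto
  moreover have "card (induced d F X) + m = m * card X" "card (induced d F Y) + m = m * card Y"
    using X Y by (auto simp: tight_def)
  moreover note card_induced_supermodular[OF fin_sub[OF F(1)], of d X Y]
  ultimately have "card (induced d F (X \<union> Y)) + m = m * card (X \<union> Y)"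
    "card (induced d F (X \<inter> Y)) + m = m * card (X \<inter> Y)"
    by linarith+
  then show "tight d m F (X \<union> Y)" "tight d m F (X \<inter> Y)"
    using XY by (auto simp: tight_def)
qed

text \<open>A new edge raises each count by at most one, so only a tight set containing both its
  ends can block it.\<close>

lemma sparse_insert:
  assumes F: "F \<subseteq> E" "sparse d m V F" and e: "e \<in> E"
    and no: "\<And>X. X \<subseteq> V \<Longrightarrow> tight d m F X \<Longrightarrow> \<not> d e \<subseteq> X"
  shows "sparse d m V (insert e F)"
  unfolding sparse_def
proof (intro allI impI)
  fix X assume X: "X \<subseteq> V" "X \<noteq> {}"
  have le: "card (induced d F X) + m \<le> m * card X" using sparseD[OF F(2) X] .
  show "card (induced d (insert e F) X) + m \<le> m * card X"
  proof (cases "d e \<subseteq> X")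
    case True
    then have "\<not> tight d m F X" using no X by blast
    then have "card (induced d F X) + m \<noteq> m * card X" using X by (simp add: tight_def)
    with le have "card (induced d F X) + m < m * card X" by linarith
    moreover have "induced d (insert e F) X \<subseteq> insert e (induced d F X)" by (auto simp: induced_def)
    then have "card (induced d (insert e F) X) \<le> card (insert e (induced d F X))"
      using fin_induced[OF F(1)] by (intro card_mono) auto
    then have "card (induced d (insert e F) X) \<le> Suc (card (induced d F X))"
      using fin_induced[OF F(1), of X] by (simp add: card_insert_if split: if_splits)
    ultimately show ?thesis by linarith
  next
    case False
    then have "induced d (insert e F) X = induced d F X" by (auto simp: induced_def)
    then show ?thesis using le by simp
  qed
qed

lemma sparse_mono: "F \<subseteq> F' \<Longrightarrow> F' \<subseteq> E \<Longrightarrow> sparse d m V F' \<Longrightarrow> sparse d m V F"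
  unfolding sparse_def
proof (intro allI impI)
  fix X assume *: "F \<subseteq> F'" "F' \<subseteq> E" "\<forall>X\<subseteq>V. X \<noteq> {} \<longrightarrow> card (induced d F' X) + m \<le> m * card X"
    "X \<subseteq> V" "X \<noteq> {}"
  have "card (induced d F X) \<le> card (induced d F' X)"
    using * by (intro card_mono fin_induced) (auto simp: induced_def)
  moreover have "card (induced d F' X) + m \<le> m * card X" using * by blast
  ultimately show "card (induced d F X) + m \<le> m * card X" by linarith
qed

text \<open>A set that blocks \<open>e\<close> after the removal of \<open>f\<close> was tight
  before and does not contain both ends of \<open>f\<close>. Its intersection with \<open>Z\<close>
  is tight and contains \<open>d e\<close>, hence is all of \<open>Z\<close> by minimality; but
  \<open>Z\<close> contains \<open>d f\<close>.\<close>

lemma sparse_exchange: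
  assumes F: "F \<subseteq> E" "sparse d m V F" and e: "e \<in> E"
    and Z: "Z \<subseteq> V" "tight d m F Z" "d e \<subseteq> Z"
    and min: "\<And>X. X \<subseteq> Z \<Longrightarrow> tight d m F X \<Longrightarrow> d e \<subseteq> X \<Longrightarrow> X = Z"
    and f: "f \<in> induced d F Z"
  shows "sparse d m V (insert e (F - {f}))"
proof (rule sparse_insert)
  show sp: "sparse d m V (F - {f})" using sparse_mono[OF _ F] by auto
  show "F - {f} \<subseteq> E" using F by auto
  fix X assume X: "X \<subseteq> V" "tight d m (F - {f}) X"
  show "\<not> d e \<subseteq> X"
  proof
    assume eX: "d e \<subseteq> X"
    have sub: "induced d (F - {f}) X \<subseteq> induced d F X" by (auto simp: induced_def)
    then have "card (induced d (F - {f}) X) \<le> card (induced d F X)"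
      by (rule card_mono[OF fin_induced[OF F(1)]])
    then have eq: "card (induced d (F - {f}) X) = card (induced d F X)" and t: "tight d m F X"
      using X(2) sparseD[OF F(2) X(1)] by (auto simp: tight_def)
    have "induced d (F - {f}) X = induced d F X"
      by (rule card_subset_eq[OF fin_induced[OF F(1)] sub eq])
    then have nf: "\<not> d f \<subseteq> X" using f by (auto simp: induced_def)
    have "X \<inter> Z \<noteq> {}" using eX Z(3) ends_nonempty[OF e] by auto
    then have "tight d m F (X \<inter> Z)" by (rule tight_Un_Int(2)[OF F X(1) t Z(1,2)])
    then have "X \<inter> Z = Z" using min eX Z by auto
    then show False using nf f by (auto simp: induced_def)
  qed
qed (rule e)

text \<open>Edges inside \<open>X\<close> but not inside \<open>A\<close> are common to
  \<open>F\<close> and \<open>F'\<close>, so the two counts differ only by what happens inside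
  \<open>X \<inter> A\<close>.\<close>

lemma card_induced_agree:
  assumes F: "F \<subseteq> E" "F' \<subseteq> E" and agree: "\<And>e. \<not> d e \<subseteq> A \<Longrightarrow> e \<in> F' \<longleftrightarrow> e \<in> F"
  shows "card (induced d F' X) + card (induced d F (X \<inter> A)) = card (induced d F X) + card (induced d F' (X \<inter> A))"
proof -
  have split: "card (induced d K X) = card (induced d K (X \<inter> A)) + card {e \<in> K. d e \<subseteq> X \<and> \<not> d e \<subseteq> A}"
    if "K \<subseteq> E" for K
  proof -
    have "induced d K X = induced d K (X \<inter> A) \<union> {e \<in> K. d e \<subseteq> X \<and> \<not> d e \<subseteq> A}"
      by (auto simp: induced_def)
    moreover have "card (induced d K (X \<inter> A) \<union> {e \<in> K. d e \<subseteq> X \<and> \<not> d e \<subseteq> A})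
        = card (induced d K (X \<inter> A)) + card {e \<in> K. d e \<subseteq> X \<and> \<not> d e \<subseteq> A}"
      using fin_sub[OF that] by (intro card_Un_disjoint) (auto simp: induced_def)
    ultimately show ?thesis by simp
  qed
  have "{e \<in> F'. d e \<subseteq> X \<and> \<not> d e \<subseteq> A} = {e \<in> F. d e \<subseteq> X \<and> \<not> d e \<subseteq> A}" using agree by auto
  then show ?thesis using split[OF F(1)] split[OF F(2)] by simp
qed

text \<open>Since \<open>A\<close> is tight in both sets, they have equally many edges inside
  \<open>A\<close>, and outside \<open>A\<close> nothing changes.\<close>

lemma tight_agree:
  assumes F: "F \<subseteq> E" "F' \<subseteq> E" and agree: "\<And>e. \<not> d e \<subseteq> A \<Longrightarrow> e \<in> F' \<longleftrightarrow> e \<in> F"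
    and A: "tight d m F A" "tight d m F' A" and X: "A \<subseteq> X"
  shows "tight d m F' X \<longleftrightarrow> tight d m F X"
proof -
  have "card (induced d F' X) + card (induced d F (X \<inter> A)) = card (induced d F X) + card (induced d F' (X \<inter> A))"
    by (rule card_induced_agree[OF F]) (rule agree)
  moreover have "X \<inter> A = A" using X by auto
  ultimately have ag: "card (induced d F' X) + card (induced d F A) = card (induced d F X) + card (induced d F' A)"
    by simp
  then have "card (induced d F' X) = card (induced d F X)"
    using A ag by (simp add: tight_def)
  then show ?thesis by (simp add: tight_def)
qed

text \<open>Suppose \<open>X\<close> meets \<open>A\<close>. By supermodularity and tightness of
  \<open>A\<close>, at most \<open>m * (card (X \<union> A) - card A)\<close> edges of
  \<open>F\<close> lie inside \<open>X\<close> but not inside \<open>A\<close>, and \<open>K\<close>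
  contributes at most \<open>m * (card (X \<inter> A) - 1)\<close> edges. The sum is at most
  \<open>m * (card X - 1)\<close>.\<close>

lemma sparse_splice:
  assumes F: "F \<subseteq> E" "sparse d m V F" "A \<subseteq> V" "tight d m F A"
    and K: "K \<subseteq> E" "sparse d m V K"
    and F': "F' \<subseteq> E" "\<And>e. \<not> d e \<subseteq> A \<Longrightarrow> e \<in> F' \<longleftrightarrow> e \<in> F" "\<And>e. d e \<subseteq> A \<Longrightarrow> e \<in> F' \<longleftrightarrow> e \<in> K"
  shows "sparse d m V F'"
  unfolding sparse_def
proof (intro allI impI)
  fix X assume X: "X \<subseteq> V" "X \<noteq> {}"
  have ag: "card (induced d F' X) + card (induced d F (X \<inter> A)) = card (induced d F X) + card (induced d F' (X \<inter> A))"
    by (rule card_induced_agree[OF F(1) F'(1)]) (rule F'(2))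
  have eqK: "induced d F' (X \<inter> A) = induced d K (X \<inter> A)" using F'(3) by (auto simp: induced_def)
  show "card (induced d F' X) + m \<le> m * card X"
  proof (cases "X \<inter> A = {}")
    case True
    have "induced d F'' {} = {}" if "F'' \<subseteq> E" for F''
      using that ends_nonempty by (auto simp: induced_def)
    then show ?thesis using ag True F F' sparseD[OF F(2) X] by simp
  next
    case False
    have 1: "card (induced d F' (X \<inter> A)) + m \<le> m * card (X \<inter> A)"
      unfolding eqK using X False by (intro sparseD[OF K(2)]) auto
    have 2: "card (induced d F (X \<union> A)) + m \<le> m * card (X \<union> A)"
      using X F(3) by (intro sparseD[OF F(2)]) auto
    have "card X + card A = card (X \<union> A) + card (X \<inter> A)"
      using X F(3) fin_vsub by (intro card_Un_Int) auto
    then have 3: "m * card X + m * card A = m * card (X \<union> A) + m * card (X \<inter> A)"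
      by (metis add_mult_distrib2)
    from card_induced_supermodular[OF fin_sub[OF F(1)], of d X A] F(4) 1 2 3 ag
    show ?thesis unfolding tight_def by linarith
  qed
qed

section \<open>Minimal tight sets, and the partition into maximal ones\<close>

lemma exists_minimal_tight:
  assumes "tight d m F V" "e \<in> E"
  obtains Z where "Z \<subseteq> V" "tight d m F Z" "d e \<subseteq> Z"
    "\<And>X. X \<subseteq> Z \<Longrightarrow> tight d m F X \<Longrightarrow> d e \<subseteq> X \<Longrightarrow> X = Z"
proof -
  let ?P = "{Z. Z \<subseteq> V \<and> tight d m F Z \<and> d e \<subseteq> Z}"
  have "finite ?P" using finV by simp
  moreover have "V \<in> ?P" using assms ends_sub by auto
  ultimately have "\<exists>Z\<in>?P. Z \<le> V \<and> (\<forall>X\<in>?P. X \<le> Z \<longrightarrow> Z = X)"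
    by (rule finite_has_minimal2)
  then obtain Z where Z: "Z \<subseteq> V" "tight d m F Z" "d e \<subseteq> Z"
    and min: "\<forall>X\<in>?P. X \<subseteq> Z \<longrightarrow> Z = X"
    by blast
  show ?thesis
  proof (rule that[OF Z])
    fix X assume "X \<subseteq> Z" "tight d m F X" "d e \<subseteq> X"
    moreover from this have "X \<in> ?P" using Z by blast
    ultimately show "X = Z" using min by blast
  qed
qed

text \<open>Otherwise all edges inside \<open>Z\<close> would lie inside \<open>Z - {v}\<close>, too
  many for that smaller set.\<close>

lemma tight_has_incident:
  assumes F: "F \<subseteq> E" "sparse d m V F" and Z: "Z \<subseteq> V" "tight d m F Z" and v: "v \<in> Z" "card Z \<ge> 2" and "m \<ge> 1"
  shows "\<exists>f\<in>induced d F Z. v \<in> d f"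
proof (rule ccontr)
  assume no: "\<not> ?thesis"
  then have "induced d F Z = induced d F (Z - {v})" by (auto simp: induced_def)
  moreover have c: "card (Z - {v}) = card Z - 1" using v by simp
  moreover have "Z - {v} \<noteq> {}"
  proof
    assume "Z - {v} = {}"
    then have "card (Z - {v}) = 0" by (simp only: card.empty)
    then show False using c v by linarith
  qed
  then have "card (induced d F (Z - {v})) + m \<le> m * card (Z - {v})" using Z by (intro sparseD[OF F(2)]) auto
  moreover have "m * (card Z - 1) < m * card Z" using v \<open>m \<ge> 1\<close> by simp
  ultimately show False using Z(2) by (simp add: tight_def)
qed


text \<open>Here \<open>t\<close> is the number of maximal tight subsets of \<open>V - S\<close>,
  and \<open>r\<close> the number of edges of \<open>V - S\<close> joining different ones. The
  equation counts \<open>H\<close>, the inequality counts all cuts around the parts in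
  \<open>E\<close>. The same \<open>r\<close> serves both, since \<open>closed\<close> puts every
  edge between parts into \<open>H\<close>.\<close>

lemma maximal_tight_partition_count:
  assumes H: "H \<subseteq> E" "sparse d m V H" and S: "S \<subseteq> V"
    and closed: "\<And>e. e \<in> E - H \<Longrightarrow> d e \<subseteq> V - S \<Longrightarrow> \<exists>A\<subseteq>V - S. tight d m H A \<and> d e \<subseteq> A"
    and cut: "\<And>X. X \<noteq> {} \<Longrightarrow> X \<subset> V \<Longrightarrow> k \<le> card (boundary d E X)"
    and nt: "S \<noteq> {} \<or> \<not> tight d m H V"
  shows "\<exists>t r. card H + card (induced d H S) + m * t = m * card (V - S) + r + (\<Sum>v\<in>S. deg d H v)
    \<and> k * t + 2 * card (induced d E S) \<le> 2 * r + (\<Sum>v\<in>S. deg d E v)"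
proof -
  define X where "X = V - S"
  have XV: "X \<subseteq> V" and finX: "finite X" using finV by (auto simp: X_def)
  \<comment> \<open>The parts: disjoint by uncrossing and maximality, covering \<open>V - S\<close>
    because singletons are tight.\<close>
  define \<P> where "\<P> = {A. A \<subseteq> X \<and> tight d m H A \<and> (\<forall>B. B \<subseteq> X \<and> tight d m H B \<and> A \<subseteq> B \<longrightarrow> B = A)}"
  have P_sub: "A \<subseteq> X" and P_tight: "tight d m H A" if "A \<in> \<P>" for A using that by (auto simp: \<P>_def)
  have P_max: "B = A" if "A \<in> \<P>" "B \<subseteq> X" "tight d m H B" "A \<subseteq> B" for A B
    using that unfolding \<P>_def by blast
  have finP: "finite \<P>" by (rule finite_subset[of _ "Pow X"]) (use finX in \<open>auto simp: \<P>_def\<close>)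
  have P_fin: "finite A" if "A \<in> \<P>" for A using P_sub[OF that] finX by (rule finite_subset)
  have P_ne: "A \<noteq> {}" if "A \<in> \<P>" for A using P_tight[OF that] by (simp add: tight_def)
  have disj: "A = B" if "A \<in> \<P>" "B \<in> \<P>" "A \<inter> B \<noteq> {}" for A B
  proof -
    have "A \<subseteq> V" "B \<subseteq> V" using P_sub that XV by blast+
    then have t: "tight d m H (A \<union> B)"
      using tight_Un_Int(1)[OF H] P_tight that by blast
    have AB: "A \<union> B \<subseteq> X" using P_sub that by blast
    have "A \<union> B = A" "A \<union> B = B"
      using P_max[OF that(1) AB t] P_max[OF that(2) AB t] by blast+
    then show ?thesis by simp
  qed
  have max: "\<exists>A\<in>\<P>. B \<subseteq> A" if "B \<subseteq> X" "tight d m H B" for B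
  proof -
    let ?Q = "{A. A \<subseteq> X \<and> tight d m H A}"
    have "finite ?Q" using finX by simp
    moreover have "B \<in> ?Q" using that by simp
    ultimately have "\<exists>A\<in>?Q. B \<le> A \<and> (\<forall>C\<in>?Q. A \<le> C \<longrightarrow> A = C)" by (rule finite_has_maximal2)
    then obtain A where "A \<subseteq> X" "tight d m H A" "B \<subseteq> A" "\<forall>C\<in>?Q. A \<le> C \<longrightarrow> A = C" by blast
    then have "A \<in> \<P>" unfolding \<P>_def by blast
    with \<open>B \<subseteq> A\<close> show ?thesis by blast
  qed
  have UnP: "\<Union>\<P> = X"
  proof
    show "\<Union>\<P> \<subseteq> X" using P_sub by blast
    show "X \<subseteq> \<Union>\<P>" using max[OF _ tight_singleton[OF H(1)]] by blast
  qed
  have pw: "pairwise disjnt \<P>" using disj by (auto simp: pairwise_def disjnt_def)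
  have cardX: "card X = (\<Sum>A\<in>\<P>. card A)"
    using card_Union_disjoint[OF pw P_fin] UnP by simp
  define R where "R F = {e \<in> F. d e \<subseteq> X \<and> (\<forall>A\<in>\<P>. \<not> d e \<subseteq> A)}" for F
  have R_eq: "R E = R H"
  proof -
    have "e \<in> H" if "e \<in> E" "d e \<subseteq> X" "\<forall>A\<in>\<P>. \<not> d e \<subseteq> A" for e
    proof (rule ccontr)
      assume "e \<notin> H"
      then have "\<exists>A\<subseteq>V - S. tight d m H A \<and> d e \<subseteq> A"
        using that by (intro closed) (auto simp: X_def)
      then obtain A where A: "A \<subseteq> X" "tight d m H A" "d e \<subseteq> A" unfolding X_def by blast
      then obtain A' where "A' \<in> \<P>" "A \<subseteq> A'" using max by blast
      then show False using A that by blast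
    qed
    then show ?thesis using H(1) by (auto simp: R_def)
  qed
  \<comment> \<open>The degree sum over \<open>S\<close> counts the edges inside \<open>S\<close>
    twice; the term \<open>card (induced d F S)\<close> on the left compensates for this.\<close>
  have split: "card F + card (induced d F S) = (\<Sum>A\<in>\<P>. card (induced d F A)) + card (R F) + (\<Sum>v\<in>S. deg d F v)"
    if F: "F \<subseteq> E" for F
  proof -
    note finF = fin_sub[OF F] and finI = fin_induced[OF F]
    have ends: "d e \<subseteq> V" "d e \<noteq> {}" if "e \<in> F" for e using that F ends_sub ends_nonempty by blast+
    have "induced d F X = (\<Union>A\<in>\<P>. induced d F A) \<union> R F"
      using P_sub by (auto simp: induced_def R_def)
    moreover have "card ((\<Union>A\<in>\<P>. induced d F A) \<union> R F) = card (\<Union>A\<in>\<P>. induced d F A) + card (R F)"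
      using finP finF by (intro card_Un_disjoint) (auto simp: induced_def R_def)
    moreover have "card (\<Union>A\<in>\<P>. induced d F A) = (\<Sum>A\<in>\<P>. card (induced d F A))"
    proof (rule card_UN_disjoint[OF finP])
      show "\<forall>A\<in>\<P>. \<forall>B\<in>\<P>. A \<noteq> B \<longrightarrow> induced d F A \<inter> induced d F B = {}"
      proof (intro ballI impI)
        fix A B assume AB: "A \<in> \<P>" "B \<in> \<P>" "A \<noteq> B"
        then have "A \<inter> B = {}" using disj by blast
        then have False if "e \<in> F" "d e \<subseteq> A" "d e \<subseteq> B" for e using that ends(2)[of e] by blast
        then show "induced d F A \<inter> induced d F B = {}" by (auto simp: induced_def)
      qed
    qed (use finI in blast)
    ultimately have 1: "card (induced d F X) = (\<Sum>A\<in>\<P>. card (induced d F A)) + card (R F)" by simp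
    have "F = induced d F X \<union> (induced d F S \<union> boundary d F S)"
      using ends(1) by (auto simp: induced_def boundary_def X_def)
    then have "card F = card (induced d F X \<union> (induced d F S \<union> boundary d F S))"
      by (rule arg_cong)
    moreover have "card (induced d F X \<union> (induced d F S \<union> boundary d F S))
      = card (induced d F X) + card (induced d F S \<union> boundary d F S)"
    proof (rule card_Un_disjoint)
      have "\<not> d e \<subseteq> X" if "e \<in> induced d F S \<union> boundary d F S" for e
      proof -
        have "d e \<inter> S \<noteq> {}" using that ends(2)[of e] by (auto simp: induced_def boundary_def)
        then show ?thesis by (auto simp: X_def)
      qed
      then show "induced d F X \<inter> (induced d F S \<union> boundary d F S) = {}"
        unfolding induced_def by blast
    qed (use finF in \<open>auto simp: induced_def boundary_def\<close>)
    moreover have "card (induced d F S \<union> boundary d F S) = card (induced d F S) + card (boundary d F S)"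
      using finF by (intro card_Un_disjoint) (auto simp: induced_def boundary_def)
    ultimately have "card F = card (induced d F X) + (card (induced d F S) + card (boundary d F S))"
      by linarith
    then show ?thesis using 1 sum_deg[OF F S] by simp
  qed
  have "(\<Sum>A\<in>\<P>. card (induced d H A) + m) = (\<Sum>A\<in>\<P>. m * card A)"
    by (rule sum.cong[OF refl]) (use P_tight in \<open>simp add: tight_def\<close>)
  then have sumH: "(\<Sum>A\<in>\<P>. card (induced d H A)) + m * card \<P> = m * card X"
    by (simp add: sum.distrib cardX sum_distrib_left mult.commute)
  have i: "card H + card (induced d H S) + m * card \<P> = m * card (V - S) + card (R H) + (\<Sum>v\<in>S. deg d H v)"
    using split[OF H(1)] sumH unfolding X_def by linarith
  have sumdeg: "(\<Sum>v\<in>X. deg d E v) = (\<Sum>A\<in>\<P>. \<Sum>v\<in>A. deg d E v)"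
  proof -
    have "\<forall>A\<in>\<P>. \<forall>B\<in>\<P>. A \<noteq> B \<longrightarrow> A \<inter> B = {}" using disj by blast
    then show ?thesis using sum.Union_disjoint[of \<P> "deg d E"] P_fin UnP by simp
  qed
  also have "\<dots> = (\<Sum>A\<in>\<P>. 2 * card (induced d E A) + card (boundary d E A))"
    by (rule sum.cong[OF refl], rule sum_deg[OF order_refl]) (use P_sub XV in blast)
  also have "\<dots> = 2 * (\<Sum>A\<in>\<P>. card (induced d E A)) + (\<Sum>A\<in>\<P>. card (boundary d E A))"
    by (simp add: sum.distrib sum_distrib_left)
  finally have sX: "(\<Sum>v\<in>X. deg d E v) = 2 * (\<Sum>A\<in>\<P>. card (induced d E A)) + (\<Sum>A\<in>\<P>. card (boundary d E A))" .
  have sV: "(\<Sum>v\<in>X. deg d E v) + (\<Sum>v\<in>S. deg d E v) = 2 * card E"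
    using handshake[OF order_refl] sum.subset_diff[OF S finV, of "deg d E"] unfolding X_def by simp
  \<comment> \<open>By \<open>nt\<close> no part is the whole of \<open>V\<close>, so each part has
    a genuine cut of at least \<open>k\<close> edges.\<close>
  have "(\<Sum>A\<in>\<P>. k) \<le> (\<Sum>A\<in>\<P>. card (boundary d E A))"
  proof (rule sum_mono)
    fix A assume A: "A \<in> \<P>"
    have "A \<noteq> V"
      using nt P_tight[OF A] P_sub[OF A] S unfolding X_def by blast
    then have "A \<subset> V" using P_sub[OF A] XV by blast
    then show "k \<le> card (boundary d E A)" using cut P_ne[OF A] by blast
  qed
  then have "k * card \<P> \<le> (\<Sum>A\<in>\<P>. card (boundary d E A))" by (simp add: mult.commute)
  then have "k * card \<P> + 2 * card (induced d E S) \<le> 2 * card (R H) + (\<Sum>v\<in>S. deg d E v)"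
    using split[OF order_refl] sX sV R_eq by simp
  with i show ?thesis by blast
qed

text \<open>A largest sparse set works. If \<open>V\<close> were not tight, the partition count with
  \<open>S = {}\<close> would give \<open>card H + m * t = m * card V + r\<close> and
  \<open>k * t \<le> 2 * r\<close>. Then \<open>m * t \<le> r\<close>, so \<open>H\<close> has at
  least \<open>m * card V\<close> edges, more than sparsity allows.\<close>

lemma exists_tight_sparse:
  assumes "V \<noteq> {}" "m \<ge> 1" "2 * m \<le> k"
    and cut: "\<And>X. X \<noteq> {} \<Longrightarrow> X \<subset> V \<Longrightarrow> k \<le> card (boundary d E X)"
  shows "\<exists>H\<subseteq>E. sparse d m V H \<and> tight d m H V"
proof -
  have bound: "card H \<le> card E" if "H \<subseteq> E" for H using that finE by (rule card_mono[rotated])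
  let ?P = "\<lambda>H. H \<subseteq> E \<and> sparse d m V H"
  have "m \<le> m * card X" if "X \<subseteq> V" "X \<noteq> {}" for X
  proof -
    have "1 \<le> card X" using that fin_vsub[of X] by (simp add: Suc_le_eq card_gt_0_iff)
    then show ?thesis by simp
  qed
  then have "?P {}" by (simp add: sparse_def induced_def)
  moreover have "\<forall>H. ?P H \<longrightarrow> card H < Suc (card E)" using bound by (simp add: less_Suc_eq_le)
  ultimately obtain H where H: "H \<subseteq> E" "sparse d m V H" and mx: "\<forall>H'. ?P H' \<longrightarrow> card H' \<le> card H"
    using ex_has_greatest_nat[of ?P "{}" card "Suc (card E)"] by blast
  have "tight d m H V"
  proof (rule ccontr)
    assume nt: "\<not> tight d m H V"
    have closed: "\<exists>A\<subseteq>V - {}. tight d m H A \<and> d e \<subseteq> A" if e: "e \<in> E - H" "d e \<subseteq> V - {}" for e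
    proof (rule ccontr)
      assume no: "\<not> ?thesis"
      have "sparse d m V (insert e H)"
        by (rule sparse_insert[OF H]) (use e no in auto)
      then have "card (insert e H) \<le> card H" using mx[rule_format, of "insert e H"] e H by simp
      then show False using e fin_sub[OF H(1)] by simp
    qed
    obtain t r where "card H + card (induced d H {}) + m * t = m * card (V - {}) + r + (\<Sum>v\<in>{}. deg d H v)"
      and kt: "k * t + 2 * card (induced d E {}) \<le> 2 * r + (\<Sum>v\<in>{}. deg d E v)"
      using maximal_tight_partition_count[OF H _ closed cut] nt by blast
    moreover have "induced d H {} = {}" using ends_nonempty H(1) by (auto simp: induced_def)
    ultimately have eq: "card H + m * t = m * card V + r" by simp
    have "2 * m * t \<le> k * t" using assms(3) by (rule mult_le_mono1)
    moreover have "k * t \<le> 2 * r" using kt by simp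
    ultimately have "m * t \<le> r" by linarith
    then have "m * card V \<le> card H" using eq by linarith
    moreover have "card H + m \<le> m * card V"
      using sparseD[OF H(2) order_refl assms(1)] induced_V[OF H(1)] by simp
    ultimately show False using assms(2) by linarith
  qed
  then show ?thesis using H by blast
qed

end

section \<open>Tight edge sets with small degrees\<close>

context mgraph
begin

text \<open>The set \<open>S\<close> is shrunk as long as possible: a vertex leaves \<open>S\<close> as soon as its degree can be
  lowered below its bound by an exchange inside a tight set that avoids the rest of \<open>S\<close>.
  Exchanges inside disjoint tight sets do not interfere with each other.\<close>

lemma exchange_closed_set:
  fixes b :: "'v \<Rightarrow> nat"
  assumes m: "m \<ge> 1" and H: "H \<subseteq> E" "sparse d m V H" "tight d m H V"
    and opt: "\<And>H'. H' \<subseteq> E \<Longrightarrow> sparse d m V H' \<Longrightarrow> tight d m H' V \<Longrightarrow>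
      (\<Sum>v\<in>V. deg d H v - b v) \<le> (\<Sum>v\<in>V. deg d H' v - b v)"
  shows "\<exists>S\<subseteq>V. (\<forall>v\<in>V. b v < deg d H v \<longrightarrow> v \<in> S) \<and> (\<forall>v\<in>S. b v \<le> deg d H v) \<and>
    (\<forall>e\<in>E - H. d e \<subseteq> V - S \<longrightarrow> (\<exists>A\<subseteq>V - S. tight d m H A \<and> d e \<subseteq> A))"
proof -
  \<comment> \<open>Changing \<open>H\<close> only inside \<open>A\<close> leaves room for one more
    edge at \<open>u\<close>, without any excess in \<open>A\<close>.\<close>
  define reducible where "reducible A u \<longleftrightarrow> (\<exists>H'\<subseteq>E. sparse d m V H' \<and> tight d m H' A \<and>
      (\<forall>e. \<not> d e \<subseteq> A \<longrightarrow> (e \<in> H' \<longleftrightarrow> e \<in> H)) \<and> (\<forall>w\<in>A. deg d H' w \<le> b w) \<and> deg d H' u < b u)" for A u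
  define Inv where "Inv S \<longleftrightarrow> S \<subseteq> V \<and> (\<forall>v\<in>V. b v < deg d H v \<longrightarrow> v \<in> S) \<and> (\<forall>v\<in>S. b v \<le> deg d H v) \<and>
      (\<forall>u\<in>V - S. \<exists>A\<subseteq>V - S. u \<in> A \<and> tight d m H A \<and> reducible A u)" for S
  \<comment> \<open>A vertex strictly below its bound is reducible in \<open>{u}\<close>, with
    \<open>H\<close> itself unchanged.\<close>
  have "Inv {v \<in> V. b v \<le> deg d H v}"
  proof -
    have "reducible {u} u" if "u \<in> V" "\<not> b u \<le> deg d H u" for u
      unfolding reducible_def using H(1,2) tight_singleton[OF H(1)] that by (intro exI[of _ H]) auto
    then show ?thesis
      unfolding Inv_def using tight_singleton[OF H(1)] by fastforce
  qed
  then obtain S where S: "Inv S" and S_min: "\<And>S'. Inv S' \<Longrightarrow> card S \<le> card S'"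
    using ex_has_least_nat[of Inv _ card] by metis
  have SV: "S \<subseteq> V" and S_exc: "\<And>v. v \<in> V \<Longrightarrow> b v < deg d H v \<Longrightarrow> v \<in> S"
    and S_sat: "\<And>v. v \<in> S \<Longrightarrow> b v \<le> deg d H v"
    and S_red: "\<And>u. u \<in> V - S \<Longrightarrow> \<exists>A\<subseteq>V - S. u \<in> A \<and> tight d m H A \<and> reducible A u"
    using S unfolding Inv_def by blast+
  have "\<exists>A\<subseteq>V - S. tight d m H A \<and> d e \<subseteq> A" if e: "e \<in> E" "e \<notin> H" "d e \<subseteq> V - S" for e
  proof (rule ccontr)
    assume no: "\<not> ?thesis"
    obtain x y where xy: "d e = {x, y}" "x \<noteq> y" using ends_card[OF e(1)] by (auto simp: card_2_iff)
    obtain A where A: "A \<subseteq> V - S" "x \<in> A" "tight d m H A" "reducible A x"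
      using S_red[of x] e(3) xy by blast
    obtain B where B: "B \<subseteq> V - S" "y \<in> B" "tight d m H B" "reducible B y"
      using S_red[of y] e(3) xy by blast
    obtain H1 where H1: "H1 \<subseteq> E" "sparse d m V H1" "tight d m H1 A" and
      H1_agree: "\<And>e. \<not> d e \<subseteq> A \<Longrightarrow> e \<in> H1 \<longleftrightarrow> e \<in> H" and
      H1_deg: "\<And>w. w \<in> A \<Longrightarrow> deg d H1 w \<le> b w" "deg d H1 x < b x"
      using A(4) unfolding reducible_def by blast
    obtain H2 where H2: "H2 \<subseteq> E" "sparse d m V H2" "tight d m H2 B" and
      H2_agree: "\<And>e. \<not> d e \<subseteq> B \<Longrightarrow> e \<in> H2 \<longleftrightarrow> e \<in> H" and
      H2_deg: "\<And>w. w \<in> B \<Longrightarrow> deg d H2 w \<le> b w" "deg d H2 y < b y"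
      using B(4) unfolding reducible_def by blast
    have AV: "A \<subseteq> V" and BV: "B \<subseteq> V" using A B by blast+
    \<comment> \<open>Otherwise \<open>A \<union> B\<close> would be a tight set in
      \<open>V - S\<close> containing \<open>e\<close>.\<close>
    have AB: "A \<inter> B = {}"
    proof (rule ccontr)
      assume "A \<inter> B \<noteq> {}"
      then have "tight d m H (A \<union> B)" by (rule tight_Un_Int(1)[OF H(1,2) AV A(3) BV B(3)])
      moreover have "A \<union> B \<subseteq> V - S" "d e \<subseteq> A \<union> B" using A B xy by auto
      ultimately show False using no by blast
    qed
    have not_both: "\<not> (d e' \<subseteq> A \<and> d e' \<subseteq> B)" if "e' \<in> E" for e'
      using AB ends_nonempty[OF that] by blast
    \<comment> \<open>Both exchanges are carried out at once; afterwards \<open>x\<close> and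
      \<open>y\<close> each have room for \<open>e\<close>.\<close>
    define H'' where "H'' = {e'\<in>E. if d e' \<subseteq> A then e' \<in> H1 else if d e' \<subseteq> B then e' \<in> H2 else e' \<in> H}"
    have K: "H'' \<subseteq> E" by (auto simp: H''_def)
    have K_A: "e' \<in> H'' \<longleftrightarrow> e' \<in> H1" if "d e' \<subseteq> A" for e'
      using that H1(1) by (auto simp: H''_def)
    have K_B: "e' \<in> H'' \<longleftrightarrow> e' \<in> H2" if "d e' \<subseteq> B" for e'
      using that H2(1) not_both[of e'] by (auto simp: H''_def)
    have K_other: "e' \<in> H'' \<longleftrightarrow> e' \<in> H" if "\<not> d e' \<subseteq> A" "\<not> d e' \<subseteq> B" for e'
      using that H(1) by (auto simp: H''_def)
    have K_notB: "e' \<in> H'' \<longleftrightarrow> e' \<in> H1" if "\<not> d e' \<subseteq> B" for e'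
      using K_A K_other H1_agree that by blast
    have ind_eq: "induced d H1 B = induced d H B"
    proof -
      have "e' \<in> H1 \<longleftrightarrow> e' \<in> H" if "d e' \<subseteq> B" for e'
        using H1_agree[of e'] not_both[of e'] that H1(1) H(1) by blast
      then show ?thesis unfolding induced_def by blast
    qed
    have tH1B: "tight d m H1 B" using B(3) by (simp add: tight_def ind_eq)
    have K_sparse: "sparse d m V H''"
      by (rule sparse_splice[OF H1(1,2) BV tH1B H2(1,2) K]) (simp_all add: K_B K_notB)
    have "induced d H'' A = induced d H1 A" using K_A by (auto simp: induced_def)
    then have tKA: "tight d m H'' A" using H1(3) by (simp add: tight_def)
    have "induced d H'' B = induced d H2 B" using K_B by (auto simp: induced_def)
    then have tKB: "tight d m H'' B" using H2(3) by (simp add: tight_def)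
    have tK: "tight d m H'' X \<longleftrightarrow> tight d m H X" if "A \<union> B \<subseteq> X" for X
    proof -
      have "A \<subseteq> X" "B \<subseteq> X" using that by auto
      then have "tight d m H1 X \<longleftrightarrow> tight d m H X"
        by (intro tight_agree[OF H(1) H1(1) H1_agree A(3) H1(3)])
      moreover have "tight d m H'' X \<longleftrightarrow> tight d m H1 X"
        by (rule tight_agree[OF H1(1) K K_notB tH1B tKB]) (use \<open>B \<subseteq> X\<close> in auto)
      ultimately show ?thesis by simp
    qed
    have inc_A: "incident d H'' w = incident d H1 w" if "w \<in> A" for w
    proof -
      have "e' \<in> H'' \<longleftrightarrow> e' \<in> H1" if "w \<in> d e'" for e'
        using that \<open>w \<in> A\<close> AB by (intro K_notB) blast
      then show ?thesis unfolding incident_def by blast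
    qed
    have inc_B: "incident d H'' w = incident d H2 w" if "w \<in> B" for w
    proof -
      have "e' \<in> H'' \<longleftrightarrow> e' \<in> H2" if "w \<in> d e'" for e'
      proof -
        have "\<not> d e' \<subseteq> A" using that \<open>w \<in> B\<close> AB by blast
        then show ?thesis using K_B[of e'] K_other[of e'] H2_agree[of e'] by blast
      qed
      then show ?thesis unfolding incident_def by blast
    qed
    have inc_other: "incident d H'' w = incident d H w" if "w \<notin> A" "w \<notin> B" for w
    proof -
      have "e' \<in> H'' \<longleftrightarrow> e' \<in> H" if "w \<in> d e'" for e'
        using that \<open>w \<notin> A\<close> \<open>w \<notin> B\<close> by (intro K_other) blast+
      then show ?thesis unfolding incident_def by blast
    qed
    have tKV: "tight d m H'' V" using tK[of V] AV BV H(3) by simp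
    obtain Z where Z: "Z \<subseteq> V" "tight d m H'' Z" "d e \<subseteq> Z"
      and Z_min: "\<And>X. X \<subseteq> Z \<Longrightarrow> tight d m H'' X \<Longrightarrow> d e \<subseteq> X \<Longrightarrow> X = Z"
      using exists_minimal_tight[OF tKV e(1)] by blast
    \<comment> \<open>All changes, including the coming exchange, happen inside \<open>W\<close>. It
      is tight in \<open>H''\<close> by uncrossing, as \<open>Z\<close> meets \<open>A\<close> in
      \<open>x\<close> and \<open>B\<close> in \<open>y\<close>, and by \<open>tK\<close> it is
      tight in \<open>H\<close> as well.\<close>
    define W where "W = Z \<union> A \<union> B"
    have WV: "W \<subseteq> V" using Z AV BV by (auto simp: W_def)
    have "tight d m H'' (Z \<union> A)"
      using tight_Un_Int(1)[OF K K_sparse Z(1,2) AV tKA] A(2) Z(3) xy by blast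
    then have tKW: "tight d m H'' W"
      unfolding W_def using tight_Un_Int(1)[OF K K_sparse _ _ BV tKB, of "Z \<union> A"] B(2) Z(1,3) AV xy by blast
    then have tW: "tight d m H W" using tK[of W] by (auto simp: W_def)
    have ZS: "Z \<inter> S \<noteq> {}"
    proof
      assume "Z \<inter> S = {}"
      then have "W \<subseteq> V - S" using A(1) B(1) Z(1) by (auto simp: W_def)
      moreover have "d e \<subseteq> W" using Z(3) by (auto simp: W_def)
      ultimately show False using no tW by blast
    qed
    have e_notin: "e \<notin> H''" using K_other[of e] e(2) xy A(2) B(2) AB by auto
    have cardZ: "2 \<le> card Z"
      using card_mono[OF fin_vsub[OF Z(1)] Z(3)] ends_card[OF e(1)] by simp
    \<comment> \<open>Insert \<open>e\<close> and drop an edge \<open>f\<close> at \<open>u\<close>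
      inside \<open>Z\<close>. Only \<open>x\<close> and \<open>y\<close> can gain, and they were
      strictly below their bounds. As \<open>u\<close> lies outside \<open>A\<close>,
      \<open>B\<close> and \<open>d e\<close>, it loses one compared with \<open>H\<close>.\<close>
    have exchange: "\<exists>H3\<subseteq>E. sparse d m V H3 \<and> tight d m H3 V \<and> tight d m H3 W \<and>
        (\<forall>e'. \<not> d e' \<subseteq> W \<longrightarrow> (e' \<in> H3 \<longleftrightarrow> e' \<in> H)) \<and> (\<forall>w\<in>A \<union> B. deg d H3 w \<le> b w) \<and>
        (\<forall>w. w \<notin> A \<union> B \<longrightarrow> deg d H3 w \<le> deg d H w) \<and> deg d H3 u < deg d H u"
      if u: "u \<in> Z \<inter> S" for u
    proof -
      obtain f where f: "f \<in> induced d H'' Z" "u \<in> d f"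
        using tight_has_incident[OF K K_sparse Z(1,2) _ cardZ m] u by blast
      define H3 where "H3 = insert e (H'' - {f})"
      have H3E: "H3 \<subseteq> E" using K e(1) by (auto simp: H3_def)
      have fK: "f \<in> H''" and fZ: "d f \<subseteq> Z" using f(1) by (auto simp: induced_def)
      have sp: "sparse d m V H3"
        unfolding H3_def by (rule sparse_exchange[OF K K_sparse e(1) Z Z_min f(1)])
      have ti: "tight d m H3 X" if "tight d m H'' X" "Z \<subseteq> X" for X
      proof -
        have "induced d H3 X = insert e (induced d H'' X - {f})"
          using that(2) Z(3) by (auto simp: H3_def induced_def)
        moreover have "f \<in> induced d H'' X" "e \<notin> induced d H'' X"
          using f that e_notin by (auto simp: induced_def)
        ultimately have "card (induced d H3 X) = card (induced d H'' X)"
          using fin_induced[OF K, of X] card_gt_0_iff[of "induced d H'' X"] by auto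
        then show ?thesis using that(1) by (simp add: tight_def)
      qed
      have uAB: "u \<notin> A" "u \<notin> B" "u \<notin> d e" using u A(1) B(1) e(3) by auto
      have fininc: "finite (incident d H'' w)" for w using fin_sub[OF K] by (simp add: incident_def)
      have deg_le: "deg d H3 w \<le> deg d H'' w" if "w \<notin> d e" for w
        using that by (intro card_mono[OF fininc]) (auto simp: H3_def incident_def)
      have deg_Suc: "deg d H3 w \<le> Suc (deg d H'' w)" for w
      proof -
        have "incident d H3 w \<subseteq> insert e (incident d H'' w)" by (auto simp: H3_def incident_def)
        then have "deg d H3 w \<le> card (insert e (incident d H'' w))"
          using fininc by (intro card_mono) auto
        then show ?thesis using fininc[of w] by (simp add: card_insert_if split: if_splits)
      qed
      have deg_u: "deg d H3 u < deg d H'' u"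
      proof (rule psubset_card_mono[OF fininc])
        have "incident d H3 u \<subseteq> incident d H'' u - {f}" using uAB(3) by (auto simp: H3_def incident_def)
        moreover have "f \<in> incident d H'' u" using f(2) fK by (simp add: incident_def)
        ultimately show "incident d H3 u \<subset> incident d H'' u" by blast
      qed
      have degAB: "deg d H3 w \<le> b w" if w: "w \<in> A \<union> B" for w
      proof (cases "w \<in> d e")
        case True
        then have "deg d H'' w < b w"
          using xy H1_deg(2) H2_deg(2) A(2) B(2) inc_A inc_B by auto
        then show ?thesis using deg_Suc[of w] by linarith
      next
        case False
        have "deg d H'' w \<le> b w" using w H1_deg(1) H2_deg(1) inc_A inc_B by auto
        then show ?thesis using deg_le[OF False] by linarith
      qed
      have deg_out: "deg d H3 w \<le> deg d H w" if w: "w \<notin> A \<union> B" for w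
      proof -
        have "w \<notin> d e" using w xy A(2) B(2) by auto
        then show ?thesis using deg_le[of w] inc_other[of w] w by simp
      qed
      have "e' \<in> H3 \<longleftrightarrow> e' \<in> H" if "\<not> d e' \<subseteq> W" for e'
      proof -
        have "e' \<noteq> e" "e' \<noteq> f" "\<not> d e' \<subseteq> A" "\<not> d e' \<subseteq> B"
          using that Z(3) fZ by (auto simp: W_def)
        then show ?thesis using K_other[of e'] by (simp add: H3_def)
      qed
      moreover have "Z \<subseteq> W" by (auto simp: W_def)
      moreover have "deg d H3 u < deg d H u" using deg_u inc_other[OF uAB(1,2)] by simp
      ultimately show ?thesis
        using H3E sp ti[OF tKV Z(1)] ti[OF tKW] degAB deg_out by (intro exI[of _ H3]) blast
    qed
    \<comment> \<open>If \<open>u\<close> exceeded its bound, the exchange would lower the total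
      excess, against the choice of \<open>H\<close>.\<close>
    have eq_b: "deg d H u = b u" if u: "u \<in> Z \<inter> S" for u
    proof (rule ccontr)
      assume "deg d H u \<noteq> b u"
      then have u_exc: "b u < deg d H u" using S_sat[of u] u by force
      obtain H3 where H3: "H3 \<subseteq> E" "sparse d m V H3" "tight d m H3 V"
        and degs: "\<forall>w\<in>A \<union> B. deg d H3 w \<le> b w" "\<forall>w. w \<notin> A \<union> B \<longrightarrow> deg d H3 w \<le> deg d H w"
          "deg d H3 u < deg d H u"
        using exchange[OF u] by blast
      have "(\<Sum>v\<in>V. deg d H3 v - b v) < (\<Sum>v\<in>V. deg d H v - b v)"
      proof (rule sum_strict_mono_ex1[OF finV])
        show "\<forall>v\<in>V. deg d H3 v - b v \<le> deg d H v - b v"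
        proof
          fix v assume "v \<in> V"
          show "deg d H3 v - b v \<le> deg d H v - b v"
            using degs(1,2) by (cases "v \<in> A \<union> B") (simp_all add: diff_le_mono)
        qed
        show "\<exists>v\<in>V. deg d H3 v - b v < deg d H v - b v"
          using u_exc degs(3) u SV by (intro bexI[of _ u]) auto
      qed
      then show False using opt[OF H3] by simp
    qed
    \<comment> \<open>All of \<open>Z \<inter> S\<close> may leave \<open>S\<close>, with
      \<open>W\<close> as the tight set for each of these vertices. Since \<open>Z\<close> meets
      \<open>S\<close>, this contradicts the minimal size of \<open>S\<close>.\<close>
    have "Inv (S - Z)"
      unfolding Inv_def
    proof (intro conjI ballI impI)
      show "S - Z \<subseteq> V" using SV by blast
      show "v \<in> S - Z" if "v \<in> V" "b v < deg d H v" for v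
        using S_exc[OF that] eq_b[of v] that by auto
      show "b v \<le> deg d H v" if "v \<in> S - Z" for v using S_sat that by blast
      fix u assume u: "u \<in> V - (S - Z)"
      show "\<exists>A\<subseteq>V - (S - Z). u \<in> A \<and> tight d m H A \<and> reducible A u"
      proof (cases "u \<in> S")
        case False
        then obtain A' where "A' \<subseteq> V - S" "u \<in> A'" "tight d m H A'" "reducible A' u"
          using S_red[of u] u by blast
        then show ?thesis by (intro exI[of _ A']) blast
      next
        case True
        then have uZ: "u \<in> Z \<inter> S" using u by blast
        obtain H3 where H3: "H3 \<subseteq> E" "sparse d m V H3" "tight d m H3 W"
          "\<forall>e'. \<not> d e' \<subseteq> W \<longrightarrow> (e' \<in> H3 \<longleftrightarrow> e' \<in> H)"
          and degs: "\<forall>w\<in>A \<union> B. deg d H3 w \<le> b w" "\<forall>w. w \<notin> A \<union> B \<longrightarrow> deg d H3 w \<le> deg d H w"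
            "deg d H3 u < deg d H u"
          using exchange[OF uZ] by blast
        have "deg d H3 w \<le> b w" if w: "w \<in> W" for w
        proof (cases "w \<in> A \<union> B")
          case False
          then have "w \<in> Z" using w by (auto simp: W_def)
          \<comment> \<open>A vertex of \<open>S\<close> in \<open>Z\<close> meets its bound with
            equality, and a vertex outside \<open>S\<close> has no excess.\<close>
          then have "deg d H w \<le> b w" using eq_b[of w] S_exc[of w] Z(1) by force
          then show ?thesis using degs(2) False le_trans by blast
        qed (use degs(1) in blast)
        moreover have "deg d H3 u < b u" using degs(3) eq_b[OF uZ] by simp
        ultimately have "reducible W u" unfolding reducible_def using H3 by blast
        moreover have "W \<subseteq> V - (S - Z)" using A(1) B(1) Z(1) by (auto simp: W_def)
        moreover have "u \<in> W" using uZ by (auto simp: W_def)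
        ultimately show ?thesis using tW by blast
      qed
    qed
    then have "card S \<le> card (S - Z)" by (rule S_min)
    moreover have "card (S - Z) < card S"
      using ZS fin_vsub[OF SV] by (intro psubset_card_mono) auto
    ultimately show False by simp
  qed
  then show ?thesis using SV S_exc S_sat by (intro exI[of _ S]) blast
qed

text \<open>The last inequality is \<open>deg d H v \<le> \<lceil>m * (deg d E v - 2 * m) /
  k\<rceil> + 2 * m\<close>, freed of the fraction and of subtraction.\<close>

theorem tight_sparse_bounded_degree:
  assumes V: "V \<noteq> {}" and m: "m \<ge> 1" and k: "2 * m \<le> k"
    and cut: "\<And>X. X \<noteq> {} \<Longrightarrow> X \<subset> V \<Longrightarrow> k \<le> card (boundary d E X)"
  shows "\<exists>H\<subseteq>E. sparse d m V H \<and> tight d m H V \<and>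
    (\<forall>v\<in>V. k * deg d H v + 2 * m * m < m * deg d E v + 2 * k * m + k)"
proof -
  \<comment> \<open>\<open>c v\<close> is \<open>k\<close> times the bound before rounding, and
    \<open>b v\<close> is \<open>c v / k\<close> rounded up. The subtraction is not truncated
    because \<open>2 * m \<le> k\<close>.\<close>
  define c where "c v = m * deg d E v + 2 * k * m - 2 * m * m" for v
  define b where "b v = (c v + (k - 1)) div k" for v
  have k0: "k > 0" using m k by linarith
  have mk: "2 * m * m \<le> 2 * k * m" using k by (intro mult_le_mono1) linarith
  have c_eq: "c v + 2 * m * m = m * deg d E v + 2 * k * m" for v
    unfolding c_def using mk by linarith
  have b_upper: "k * b v < c v + k" for v
  proof -
    have "k * b v \<le> c v + (k - 1)" unfolding b_def by (rule times_div_less_eq_dividend)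
    then show ?thesis using k0 by linarith
  qed
  have b_lower: "c v \<le> k * b v" for v
  proof -
    have "c v + (k - 1) < k * b v + k"
      unfolding b_def using dividend_less_times_div[OF k0, of "c v + (k - 1)"] by simp
    then show ?thesis using k0 by linarith
  qed
  let ?P = "\<lambda>H. H \<subseteq> E \<and> sparse d m V H \<and> tight d m H V"
  let ?ex = "\<lambda>H. \<Sum>v\<in>V. deg d H v - b v"
  obtain H0 where "?P H0" using exists_tight_sparse[OF V m k cut] by blast
  then obtain H where PH: "?P H" and opt: "\<And>H'. ?P H' \<Longrightarrow> ?ex H \<le> ?ex H'"
    using ex_has_least_nat[of ?P H0 ?ex] by blast
  then have H: "H \<subseteq> E" "sparse d m V H" "tight d m H V" by blast+
  have opt': "?ex H \<le> ?ex H'" if "H' \<subseteq> E" "sparse d m V H'" "tight d m H' V" for H'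
    using opt that by blast
  have "deg d H v \<le> b v" if v: "v \<in> V" for v
  proof (rule ccontr)
    assume "\<not> deg d H v \<le> b v"
    have "\<exists>S\<subseteq>V. (\<forall>v\<in>V. b v < deg d H v \<longrightarrow> v \<in> S) \<and> (\<forall>v\<in>S. b v \<le> deg d H v) \<and>
        (\<forall>e\<in>E - H. d e \<subseteq> V - S \<longrightarrow> (\<exists>A\<subseteq>V - S. tight d m H A \<and> d e \<subseteq> A))"
      by (rule exchange_closed_set[OF m H]) (rule opt')
    then obtain S where S: "S \<subseteq> V" "\<forall>v\<in>V. b v < deg d H v \<longrightarrow> v \<in> S" "\<forall>v\<in>S. b v \<le> deg d H v"
      and S_closed: "\<forall>e\<in>E - H. d e \<subseteq> V - S \<longrightarrow> (\<exists>A\<subseteq>V - S. tight d m H A \<and> d e \<subseteq> A)"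
      by (elim exE conjE)
    have closed: "\<exists>A\<subseteq>V - S. tight d m H A \<and> d e \<subseteq> A" if "e \<in> E - H" "d e \<subseteq> V - S" for e
      using bspec[OF S_closed that(1)] that(2) by (rule mp)
    have vS: "v \<in> S" using S(2) v \<open>\<not> deg d H v \<le> b v\<close> by simp
    have finS: "finite S" using S(1) by (rule fin_vsub)
    obtain t r where t: "card H + card (induced d H S) + m * t = m * card (V - S) + r + (\<Sum>v\<in>S. deg d H v)"
      "k * t + 2 * card (induced d E S) \<le> 2 * r + (\<Sum>v\<in>S. deg d E v)"
      using maximal_tight_partition_count[OF H(1,2) S(1) closed cut] vS by blast
    define s D DE h g where "s = int (card S)" and "D = int (\<Sum>v\<in>S. deg d H v)"
      and "DE = int (\<Sum>v\<in>S. deg d E v)" and "h = int (card (induced d H S))"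
      and "g = int (card (induced d E S))"
    define k' m' t' r' where "k' = int k" and "m' = int m" and "t' = int t" and "r' = int r"
    note defs = s_def D_def DE_def h_def g_def k'_def m'_def t'_def r'_def
    have cV: "card (V - S) + card S = card V"
      using S(1) finV finS by (simp add: card_Diff_subset card_mono)
    have "card H + m = m * card V" using H(3) induced_V[OF H(1)] by (simp add: tight_def)
    then have "card H + m = m * card (V - S) + m * card S" using cV by (metis add_mult_distrib2)
    then have "m * card S + card (induced d H S) + m * t = m + r + (\<Sum>v\<in>S. deg d H v)"
      using t(1) by linarith
    then have "int (m * card S + card (induced d H S) + m * t) = int (m + r + (\<Sum>v\<in>S. deg d H v))"
      by simp
    then have 1: "m' * s + h + m' * t' = m' + r' + D" by (simp add: defs)
    have "int (k * t + 2 * card (induced d E S)) \<le> int (2 * r + (\<Sum>v\<in>S. deg d E v))"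
      using t(2) by (rule zle_int[THEN iffD2])
    then have 2: "k' * t' + 2 * g \<le> 2 * r' + DE" by (simp add: defs)
    have "card (induced d H S) \<le> card (induced d E S)"
      using H(1) by (intro card_mono fin_induced) (auto simp: induced_def)
    then have 3: "h \<le> g" by (simp add: defs)
    have "card (induced d H S) + m \<le> m * card S" using sparseD[OF H(2) S(1)] vS by blast
    then have "int (card (induced d H S) + m) \<le> int (m * card S)" by (rule zle_int[THEN iffD2])
    then have 4: "h + m' \<le> m' * s" by (simp add: defs)
    \<comment> \<open>Every vertex of \<open>S\<close> reaches its bound and \<open>v\<close>
      exceeds it, so the sum is strictly larger.\<close>
    have "(\<Sum>w\<in>S. c w) < (\<Sum>w\<in>S. k * deg d H w)"
    proof (rule sum_strict_mono_ex1[OF finS])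
      show "\<forall>w\<in>S. c w \<le> k * deg d H w" using b_lower S(3) by (meson le_trans mult_le_mono2)
      have "k * b v < k * deg d H v" using k0 \<open>\<not> deg d H v \<le> b v\<close> by simp
      then show "\<exists>w\<in>S. c w < k * deg d H w" using vS b_lower[of v] by (intro bexI[of _ v]) linarith+
    qed
    moreover have "(\<Sum>w\<in>S. c w) + card S * (2 * m * m) = m * (\<Sum>w\<in>S. deg d E w) + card S * (2 * k * m)"
    proof -
      have "(\<Sum>w\<in>S. c w + 2 * m * m) = (\<Sum>w\<in>S. m * deg d E w + 2 * k * m)" by (simp only: c_eq)
      then show ?thesis by (simp add: sum.distrib sum_distrib_left)
    qed
    ultimately have "m * (\<Sum>w\<in>S. deg d E w) + card S * (2 * k * m) < k * (\<Sum>w\<in>S. deg d H w) + card S * (2 * m * m)"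
      by (simp add: sum_distrib_left)
    then have "int (m * (\<Sum>w\<in>S. deg d E w) + card S * (2 * k * m)) < int (k * (\<Sum>w\<in>S. deg d H w) + card S * (2 * m * m))"
      by (rule of_nat_less_iff[THEN iffD2])
    then have 5: "m' * DE + s * (2 * k' * m') < k' * D + s * (2 * m' * m')"
      by (simp add: defs)
    have 6: "m' \<ge> 1" "2 * m' \<le> k'" "r' \<ge> 0" using m k by (auto simp: defs)
    have e1: "k' * (m' * s + h + m' * t') = k' * (m' + r' + D)" using 1 by simp
    have e2: "m' * (k' * t' + 2 * g) \<le> m' * (2 * r' + DE)" using 2 6 by (intro mult_left_mono) auto
    have e3: "0 \<le> (k' - 2 * m') * r'" using 6 by simp
    have e4: "0 \<le> (k' - 2 * m') * (m' * s - m' - h)" using 6 4 by simp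
    have e5: "m' * h \<le> m' * g" using 3 6 by (intro mult_left_mono) auto
    have e6: "m' * m' \<le> k' * m'" using 6 by (intro mult_right_mono) auto
    \<comment> \<open>Eliminating \<open>t'\<close>, \<open>r'\<close>, \<open>g\<close> and
      \<open>h\<close> gives \<open>k' * D \<le> m' * DE + 2 * k' * m' * s - 2 * m' * m' * s - 2 *
      m' * (k' - m')\<close>, which contradicts \<open>5\<close> as
      \<open>m' \<le> k'\<close>.\<close>
    from e1 e2 e3 e4 e5 e6 5 show False by (simp add: algebra_simps)
  qed
  then have "k * deg d H v \<le> k * b v" if "v \<in> V" for v
    using that by simp
  then have "k * deg d H v + 2 * m * m < m * deg d E v + 2 * k * m + k" if "v \<in> V" for v
    using add_strict_right_mono[OF le_less_trans[OF _ b_upper], of "k * deg d H v" v "2 * m * m"] that c_eq[of v]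
    by (simp add: ac_simps)
  then show ?thesis using H by blast
qed

end

section \<open>Two disjoint connected subgraphs, and T-joins\<close>

lemma cut_connectedD:
  assumes "cut_connected d V F" "X \<noteq> {}" "X \<subset> V"
  obtains e where "e \<in> F" "d e \<inter> X \<noteq> {}" "\<not> d e \<subseteq> X"
proof -
  have "boundary d F X \<noteq> {}" using assms by (simp add: cut_connected_def psubset_eq)
  then show ?thesis using that by (auto simp: boundary_def)
qed

lemma boundary_mono: "F \<subseteq> F' \<Longrightarrow> boundary d F X \<subseteq> boundary d F' X"
  by (auto simp: boundary_def)

lemma cut_connected_mono: "cut_connected d V F \<Longrightarrow> F \<subseteq> F' \<Longrightarrow> cut_connected d V F'"
  unfolding cut_connected_def by (metis boundary_mono subset_empty)

text \<open>A cut of \<open>V\<close> either restricts to a cut of \<open>V - {v}\<close>, or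
  separates \<open>v\<close> from all other vertices and is crossed by \<open>e\<close>.\<close>

lemma cut_connected_extend:
  assumes conn: "cut_connected d (V - {v}) F" and e: "d e = {v, x}" "x \<in> V" "x \<noteq> v" and v: "v \<in> V"
    and sub: "\<And>f. f \<in> F \<Longrightarrow> d f \<subseteq> V - {v}"
  shows "cut_connected d V (insert e F)"
  unfolding cut_connected_def
proof (intro allI impI)
  fix X assume X: "X \<noteq> {} \<and> X \<subset> V"
  show "boundary d (insert e F) X \<noteq> {}"
  proof (cases "X - {v} \<noteq> {} \<and> X - {v} \<noteq> V - {v}")
    case True
    then have "X - {v} \<noteq> {}" "X - {v} \<subset> V - {v}" using X by blast+
    then obtain f where f: "f \<in> F" "d f \<inter> (X - {v}) \<noteq> {}" "\<not> d f \<subseteq> X - {v}"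
      using cut_connectedD[OF conn] by metis
    then have "f \<in> boundary d (insert e F) X" using sub[OF f(1)] by (auto simp: boundary_def)
    then show ?thesis by blast
  next
    case False
    then have "X = {v} \<or> X = V - {v}" using X v by blast
    then have "e \<in> boundary d (insert e F) X" using e by (auto simp: boundary_def)
    then show ?thesis by blast
  qed
qed

text \<open>The edge \<open>e\<close> from \<open>x\<close> to \<open>y\<close> is subdivided by \<open>v\<close>: it becomes an edge from \<open>v\<close> to \<open>x\<close>, and \<open>f\<close>
  is the other half.\<close>

lemma cut_connected_subdivide:
  assumes conn: "cut_connected (d(e := {x, y})) (V - {v}) F" and e: "d e = {v, x}" and f: "d f = {v, y}"
    and xy: "x \<in> V" "x \<noteq> v" "y \<in> V" "y \<noteq> v" and v: "v \<in> V" and eF: "e \<in> F"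
    and sub: "\<And>f. f \<in> F \<Longrightarrow> f \<noteq> e \<Longrightarrow> d f \<subseteq> V - {v}"
  shows "cut_connected d V (insert f F)"
  unfolding cut_connected_def
proof (intro allI impI)
  fix X assume X: "X \<noteq> {} \<and> X \<subset> V"
  show "boundary d (insert f F) X \<noteq> {}"
  proof (cases "X - {v} \<noteq> {} \<and> X - {v} \<noteq> V - {v}")
    case True
    then have "X - {v} \<noteq> {}" "X - {v} \<subset> V - {v}" using X by blast+
    then obtain g where g: "g \<in> F" "(d(e := {x, y})) g \<inter> (X - {v}) \<noteq> {}" "\<not> (d(e := {x, y})) g \<subseteq> X - {v}"
      using cut_connectedD[OF conn] by metis
    have "g \<in> boundary d (insert f F) X \<or> f \<in> boundary d (insert f F) X"
    proof (cases "g = e")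
      case True
      \<comment> \<open>Here \<open>X\<close> separates \<open>x\<close> from \<open>y\<close>; on
        whichever side \<open>v\<close> lies, one of the two halves crosses.\<close>
      then show ?thesis using g e f xy by (auto simp: boundary_def)
    next
      case False
      then show ?thesis using g sub[OF g(1) False] by (auto simp: boundary_def)
    qed
    then show ?thesis by blast
  next
    case False
    then have "X = {v} \<or> X = V - {v}" using X v by blast
    then have "f \<in> boundary d (insert f F) X" using f xy by (auto simp: boundary_def)
    then show ?thesis by blast
  qed
qed

text \<open>Henneberg's construction read backwards: some vertex has degree 2 or 3. In the latter case one
  of its edges can be moved away so that it joins two of its neighbours.\<close>

lemma two_disjoint_connected:
  assumes "mgraph V E d" "V \<noteq> {}" "sparse d 2 V E" "tight d 2 E V"
  shows "\<exists>A B. A \<subseteq> E \<and> B \<subseteq> E \<and> A \<inter> B = {} \<and> cut_connected d V A \<and> cut_connected d V B"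
  using assms
proof (induction "card V" arbitrary: V E d rule: less_induct)
  case less
  then interpret mgraph V E d by simp
  note ne = less.prems(2) and sp = less.prems(3) and ti = less.prems(4)
  have cardE: "card E + 2 = 2 * card V" using ti induced_V[OF order_refl] by (simp add: tight_def)
  show ?case
  proof (cases "card V = 1")
    case True
    then obtain v where "V = {v}" by (auto simp: card_1_singleton_iff)
    then have "cut_connected d V {}" by (auto simp: cut_connected_def)
    then show ?thesis by blast
  next
    case False
    have "card V \<noteq> 0" using ne finV by simp
    with False have cV: "card V \<ge> 2" by simp
    \<comment> \<open>The degree sum is \<open>4 * card V - 4\<close>.\<close>
    have "\<exists>v\<in>V. deg d E v \<le> 3"
    proof (rule ccontr)
      assume "\<not> ?thesis"
      then have "(\<Sum>v\<in>V. 4) \<le> (\<Sum>v\<in>V. deg d E v)" by (intro sum_mono) force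
      then show False using handshake[OF order_refl] cardE by simp
    qed
    then obtain v where v: "v \<in> V" and deg3: "deg d E v \<le> 3" by blast
    define V' where "V' = V - {v}"
    define N where "N = incident d E v"
    define F where "F = E - N"
    have cV': "card V' = card V - 1" using v by (simp add: V'_def)
    have V'ne: "V' \<noteq> {}" using cV cV' by force
    have finN: "finite N" and NE: "N \<subseteq> E" using finE by (auto simp: N_def incident_def)
    have FE: "F \<subseteq> E" by (auto simp: F_def)
    have F_sub: "d e \<subseteq> V'" if "e \<in> F" for e
      using that ends_sub[of e] by (auto simp: F_def N_def incident_def V'_def)
    have cardF: "card F + card N = card E"
      using NE finE card_mono[OF finE NE] by (simp add: F_def card_Diff_subset finN)
    have indF: "induced d E V' = F"
      using F_sub by (auto simp: induced_def F_def N_def incident_def V'_def)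
    have "card F + 2 \<le> 2 * card V'"
      using sparseD[OF sp, of V'] V'ne indF by (auto simp: V'_def)
    then have deg2: "2 \<le> card N" using cardF cardE cV cV' by linarith
    have spF: "sparse d 2 V' F"
      unfolding sparse_def
    proof (intro allI impI)
      fix X assume X: "X \<subseteq> V'" "X \<noteq> {}"
      have "card (induced d F X) \<le> card (induced d E X)"
        using FE by (intro card_mono fin_induced) (auto simp: induced_def)
      moreover have "X \<subseteq> V" using X by (auto simp: V'_def)
      ultimately show "card (induced d F X) + 2 \<le> 2 * card X"
        using sparseD[OF sp _ X(2)] by fastforce
    qed
    have mgF: "mgraph V' F d"
      using F_sub FE finV finE ends_card by unfold_locales (auto simp: V'_def intro: finite_subset)
    define other where "other e = (THE x. d e = {v, x} \<and> x \<noteq> v)" for e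
    have other: "d e = {v, other e}" "other e \<noteq> v" "other e \<in> V" "other e \<in> V'" if "e \<in> N" for e
    proof -
      have e: "e \<in> E" "v \<in> d e" using that by (auto simp: N_def incident_def)
      obtain a b where "d e = {a, b}" "a \<noteq> b" using ends_card[OF e(1)] by (auto simp: card_2_iff)
      then obtain x where x: "d e = {v, x}" "x \<noteq> v" using e(2) by (metis insertE insert_commute singletonD)
      have "other e = x" unfolding other_def by (rule the_equality) (use x in \<open>auto simp: doubleton_eq_iff\<close>)
      with x ends_sub[OF e(1)] show "d e = {v, other e}" "other e \<noteq> v" "other e \<in> V" "other e \<in> V'"
        by (auto simp: V'_def)
    qed
    have attach: "cut_connected d V (insert e K)" if "e \<in> N" "K \<subseteq> F" "cut_connected d V' K" for e K
    proof (rule cut_connected_extend)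
      show "cut_connected d (V - {v}) K" using that(3) by (simp add: V'_def)
      show "d f \<subseteq> V - {v}" if "f \<in> K" for f using F_sub[of f] that \<open>K \<subseteq> F\<close> by (auto simp: V'_def)
    qed (use other[OF that(1)] v in auto)
    show ?thesis
    \<comment> \<open>With degree 2, each of the two subgraphs of \<open>V - {v}\<close> receives
      one edge at \<open>v\<close>.\<close>
    proof (cases "card N = 2")
      case True
      then obtain e1 e2 where N2: "N = {e1, e2}" "e1 \<noteq> e2" by (auto simp: card_2_iff)
      have "tight d 2 F V'"
        using cardF cardE cV cV' True V'ne mgraph.induced_V[OF mgF order_refl] by (simp add: tight_def)
      then obtain A B where AB: "A \<subseteq> F" "B \<subseteq> F" "A \<inter> B = {}" "cut_connected d V' A" "cut_connected d V' B"
        using less.hyps[of V' F d] cV cV' mgF V'ne spF by auto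
      have "cut_connected d V (insert e1 A)" "cut_connected d V (insert e2 B)"
        using AB N2 by (auto intro: attach)
      moreover have "e1 \<notin> F" "e2 \<notin> F" using N2(1) by (auto simp: F_def)
      moreover have "insert e1 A \<subseteq> E" "insert e2 B \<subseteq> E" using AB(1,2) FE NE N2(1) by auto
      moreover have "insert e1 A \<inter> insert e2 B = {}"
        using AB(1-3) N2(2) \<open>e1 \<notin> F\<close> \<open>e2 \<notin> F\<close> by auto
      ultimately show ?thesis by blast
    next
      case False
      then have N3: "card N = 3" using deg2 deg3 by (simp add: N_def)
      \<comment> \<open>Such an \<open>X\<close> together with \<open>v\<close> would contain
        \<open>2 * card X - 2 + 3\<close> edges, one more than sparsity allows.\<close>
      have tight_miss: "\<not> other ` N \<subseteq> X" if X: "X \<subseteq> V'" "tight d 2 F X" for X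
      proof
        assume sub: "other ` N \<subseteq> X"
        have Xne: "X \<noteq> {}" and cX: "card (induced d F X) + 2 = 2 * card X"
          using X(2) by (auto simp: tight_def)
        have finX: "finite X" using X(1) finV by (auto simp: V'_def intro: finite_subset)
        have vX: "v \<notin> X" using X(1) by (auto simp: V'_def)
        have "N \<inter> induced d F X = {}" by (auto simp: F_def induced_def)
        then have "card (N \<union> induced d F X) = card N + card (induced d F X)"
          using finN fin_induced[OF FE] by (intro card_Un_disjoint)
        moreover have "card (N \<union> induced d F X) \<le> card (induced d E (insert v X))"
        proof (rule card_mono[OF fin_induced[OF order_refl]])
          have "e \<in> induced d E (insert v X)" if "e \<in> N" for e
            using other(1)[OF that] sub that NE by (auto simp: induced_def)
          then show "N \<union> induced d F X \<subseteq> induced d E (insert v X)"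
            using FE by (auto simp: induced_def)
        qed
        moreover have "card (induced d E (insert v X)) + 2 \<le> 2 * card (insert v X)"
          using X(1) v by (intro sparseD[OF sp]) (auto simp: V'_def)
        ultimately show False using N3 cX finX vX by simp
      qed
      \<comment> \<open>Otherwise tight sets joining \<open>other e0\<close> to each further
        neighbour could be united by uncrossing into one that contains all neighbours.\<close>
      have "\<exists>e1\<in>N. \<exists>e2\<in>N. other e1 \<noteq> other e2 \<and>
        (\<forall>X\<subseteq>V'. tight d 2 F X \<longrightarrow> \<not> {other e1, other e2} \<subseteq> X)"
      proof (rule ccontr)
        assume no: "\<not> ?thesis"
        obtain e0 where e0: "e0 \<in> N" using N3 by fastforce
        have "\<exists>X. X \<subseteq> V' \<and> tight d 2 F X \<and> other e0 \<in> X \<and> other ` M \<subseteq> X"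
          if "M \<subseteq> N" "finite M" for M
          using that(2,1)
        proof (induction M)
          case empty
          show ?case
            using mgraph.tight_singleton[OF mgF order_refl, of 2 "other e0"] other(4)[OF e0]
            by (intro exI[of _ "{other e0}"]) auto
        next
          case (insert e M)
          then obtain X where X: "X \<subseteq> V'" "tight d 2 F X" "other e0 \<in> X" "other ` M \<subseteq> X" by blast
          show ?case
          proof (cases "other e = other e0")
            case True
            then show ?thesis using X by auto
          next
            case False
            then obtain Y where Y: "Y \<subseteq> V'" "tight d 2 F Y" "{other e, other e0} \<subseteq> Y"
              using no e0 insert.prems by (metis insert_subset)
            have "tight d 2 F (X \<union> Y)"
              using mgraph.tight_Un_Int(1)[OF mgF order_refl spF X(1,2) Y(1,2)] X(3) Y(3) by blast
            then show ?thesis using X Y by (intro exI[of _ "X \<union> Y"]) auto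
          qed
        qed
        then show False using tight_miss finN by blast
      qed
      then obtain e1 e2 where e12: "e1 \<in> N" "e2 \<in> N" "other e1 \<noteq> other e2"
        and no_tight: "\<And>X. X \<subseteq> V' \<Longrightarrow> tight d 2 F X \<Longrightarrow> \<not> {other e1, other e2} \<subseteq> X" by blast
      have "e1 \<noteq> e2" using e12(3) by auto
      then have "card (N - {e1, e2}) = 1"
        using e12(1,2) N3 finN by (subst card_Diff_subset) auto
      then obtain e3 where e3: "N - {e1, e2} = {e3}" by (auto simp: card_1_singleton_iff)
      \<comment> \<open>The edge \<open>e1\<close> keeps its name and is moved to join the two
        neighbours; no tight set blocks it there.\<close>
      define d' where "d' = d(e1 := {other e1, other e2})"
      define F' where "F' = insert e1 F"
      have e1F: "e1 \<notin> F" "e2 \<notin> F" "e3 \<notin> F" using e12 e3 by (auto simp: F_def)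
      have d'_eq: "d' e = d e" if "e \<noteq> e1" for e using that by (simp add: d'_def)
      have mgF': "mgraph V' F' d'"
      proof
        show "finite V'" "finite F'" using finV finE FE by (auto simp: V'_def F'_def intro: finite_subset)
        show "d' e \<subseteq> V'" "card (d' e) = 2" if "e \<in> F'" for e
          using that F_sub[of e] ends_card[of e] FE other(4)[OF e12(1)] other(4)[OF e12(2)] e12(3)
          by (auto simp: F'_def d'_def)
      qed
      have ind_d': "induced d' F X = induced d F X" for X
      proof -
        have "d' e = d e" if "e \<in> F" for e using d'_eq[of e] e1F that by blast
        then show ?thesis unfolding induced_def by auto
      qed
      have spF': "sparse d' 2 V' F'"
        unfolding F'_def
      proof (rule mgraph.sparse_insert[OF mgF'])
        show "sparse d' 2 V' F" using spF by (simp add: sparse_def ind_d')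
        show "\<not> d' e1 \<subseteq> X" if "X \<subseteq> V'" "tight d' 2 F X" for X
        proof -
          have "tight d 2 F X" using that(2) by (simp add: tight_def ind_d')
          then show ?thesis using no_tight[OF that(1)] by (simp add: d'_def)
        qed
      qed (auto simp: F'_def)
      have "card F' = card F + 1" using e1F fin_sub[OF FE] by (simp add: F'_def)
      then have "tight d' 2 F' V'"
        using cardF cardE cV cV' N3 V'ne mgraph.induced_V[OF mgF' order_refl] by (simp add: tight_def)
      \<comment> \<open>As \<open>A\<close> and \<open>B\<close> are disjoint and play symmetric
        roles, \<open>e1\<close> may be assumed not to lie in \<open>B\<close>.\<close>
      then have "\<exists>A B. A \<subseteq> F' \<and> B \<subseteq> F' \<and> A \<inter> B = {} \<and> cut_connected d' V' A \<and> cut_connected d' V' B"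
        using less.hyps[of V' F' d'] cV cV' mgF' V'ne spF' by auto
      then obtain A B where AB: "A \<subseteq> F'" "B \<subseteq> F'" "A \<inter> B = {}" "cut_connected d' V' A" "cut_connected d' V' B"
        and e1B: "e1 \<notin> B" by blast
      have BF: "B \<subseteq> F" using AB(2) e1B by (auto simp: F'_def)
      have "cut_connected d V' B"
      proof -
        have "d' e = d e" if "e \<in> B" for e using d'_eq e1B that by metis
        then have "boundary d' B X = boundary d B X" for X by (auto simp: boundary_def)
        then show ?thesis using AB(5) by (simp add: cut_connected_def)
      qed
      then have connB: "cut_connected d V (insert e3 B)"
        using BF e3 by (intro attach) auto
      \<comment> \<open>If \<open>A\<close> uses the moved edge, \<open>e1\<close> and
        \<open>e2\<close> subdivide it at \<open>v\<close>; otherwise \<open>e2\<close> attaches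
        \<open>v\<close>. The third edge \<open>e3\<close> attaches \<open>v\<close> to
        \<open>B\<close>.\<close>
      have connA: "cut_connected d V (insert e2 A)"
      proof (cases "e1 \<in> A")
        case True
        show ?thesis
        proof (rule cut_connected_subdivide)
          show "cut_connected (d(e1 := {other e1, other e2})) (V - {v}) A"
            using AB(4) by (simp add: d'_def V'_def)
          show "d f \<subseteq> V - {v}" if "f \<in> A" "f \<noteq> e1" for f
            using that AB(1) F_sub[of f] by (auto simp: F'_def V'_def)
        qed (use other[OF e12(1)] other[OF e12(2)] v True in auto)
      next
        case False
        have AF: "A \<subseteq> F" using AB(1) False by (auto simp: F'_def)
        have "d' e = d e" if "e \<in> A" for e using d'_eq False that by metis
        then have "boundary d' A X = boundary d A X" for X by (auto simp: boundary_def)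
        then have "cut_connected d V' A" using AB(4) by (simp add: cut_connected_def)
        then show ?thesis using AF e12(2) by (intro attach)
      qed
      have "e3 \<in> N" "e3 \<noteq> e1" "e3 \<noteq> e2" "e1 \<noteq> e2" using e3 e12 by auto
      then have "insert e2 A \<subseteq> E" "insert e3 B \<subseteq> E" "insert e2 A \<inter> insert e3 B = {}"
        using AB(1,3) BF FE NE e12 e1F by (auto simp: F'_def)
      then show ?thesis using connA connB by blast
    qed
  qed
qed

section \<open>Spanning trees, degree parities and T-joins\<close>

context mgraph
begin

text \<open>For \<open>m = 1\<close> these are spanning trees. With an empty cut, sparsity on both
  sides would allow only \<open>card V - 2\<close> edges.\<close>

lemma tight_imp_cut_connected:
  assumes H: "H \<subseteq> E" "sparse d 1 V H" "tight d 1 H V"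
  shows "cut_connected d V H"
  unfolding cut_connected_def
proof (intro allI impI notI)
  fix X assume X: "X \<noteq> {} \<and> X \<subset> V" and no: "boundary d H X = {}"
  have "d e \<subseteq> X \<or> d e \<subseteq> V - X" if "e \<in> H" for e
    using no that ends_sub[of e] H(1) by (auto simp: boundary_def)
  then have "H \<subseteq> induced d H X \<union> induced d H (V - X)" by (auto simp: induced_def)
  then have "card H \<le> card (induced d H X \<union> induced d H (V - X))"
    using fin_induced[OF H(1)] by (intro card_mono) auto
  also have "\<dots> \<le> card (induced d H X) + card (induced d H (V - X))" by (rule card_Un_le)
  finally have 1: "card H \<le> card (induced d H X) + card (induced d H (V - X))" .
  have "card (induced d H X) + 1 \<le> 1 * card X" "card (induced d H (V - X)) + 1 \<le> 1 * card (V - X)"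
    using X by (intro sparseD[OF H(2)]; blast)+
  moreover have "card X + card (V - X) = card V"
    using X finV by (metis card_Diff_subset card_mono le_add_diff_inverse psubset_imp_subset rev_finite_subset)
  moreover have "card H + 1 = card V" using H(3) induced_V[OF H(1)] by (simp add: tight_def)
  ultimately show False using 1 by linarith
qed

text \<open>The edges of \<open>J \<inter> K\<close> are counted in both degrees and cancel modulo
  2.\<close>

lemma odd_deg_sym_diff:
  assumes "J \<subseteq> E" "K \<subseteq> E"
  shows "odd (deg d ((J - K) \<union> (K - J)) v) \<longleftrightarrow> odd (deg d J v) \<noteq> odd (deg d K v)"
proof -
  have fin: "finite (incident d F v)" if "F \<subseteq> E" for F using fin_sub[OF that] by (simp add: incident_def)
  have sub: "J - K \<subseteq> E" "K - J \<subseteq> E" "J \<inter> K \<subseteq> E" using assms by auto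
  have "incident d ((J - K) \<union> (K - J)) v = incident d (J - K) v \<union> incident d (K - J) v"
    "incident d J v = incident d (J - K) v \<union> incident d (J \<inter> K) v"
    "incident d K v = incident d (K - J) v \<union> incident d (J \<inter> K) v"
    by (auto simp: incident_def)
  moreover have "incident d (J - K) v \<inter> incident d (K - J) v = {}"
    "incident d (J - K) v \<inter> incident d (J \<inter> K) v = {}" "incident d (K - J) v \<inter> incident d (J \<inter> K) v = {}"
    by (auto simp: incident_def)
  ultimately show ?thesis
    by (simp add: card_Un_disjoint fin sub) blast
qed

text \<open>Vertices of \<open>T\<close> are removed in pairs; joins for pairs are combined by
  symmetric difference, which adds degrees modulo 2.\<close>

lemma T_join:
  assumes H: "H \<subseteq> E" "cut_connected d V H" and T: "T \<subseteq> V" "even (card T)"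
  shows "\<exists>J\<subseteq>H. \<forall>v\<in>V. odd (deg d J v) \<longleftrightarrow> v \<in> T"
proof -
  have sum: "\<exists>L\<subseteq>H. \<forall>v\<in>V. odd (deg d L v) \<longleftrightarrow> odd (deg d J v) \<noteq> odd (deg d K v)"
    if "J \<subseteq> H" "K \<subseteq> H" for J K
    using odd_deg_sym_diff[of J K] that H(1) by (intro exI[of _ "(J - K) \<union> (K - J)"]) auto
  have pair: "\<exists>J\<subseteq>H. \<forall>v\<in>V. odd (deg d J v) \<longleftrightarrow> (v = x) \<noteq> (v = y)" if x: "x \<in> V" and y: "y \<in> V" for x y
  proof -
    \<comment> \<open>The vertices \<open>z\<close> with a join for the pair \<open>x\<close>,
      \<open>z\<close>. The exclusive or makes the empty set a join when \<open>z = x\<close>, and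
      an edge leaving \<open>X\<close> extends a join to its other end.\<close>
    define X where "X = {z\<in>V. \<exists>J\<subseteq>H. \<forall>v\<in>V. odd (deg d J v) \<longleftrightarrow> (v = x) \<noteq> (v = z)}"
    have "{} \<subseteq> H \<and> (\<forall>v\<in>V. odd (deg d {} v) \<longleftrightarrow> (v = x) \<noteq> (v = x))" by (simp add: incident_def)
    then have "x \<in> X" using x unfolding X_def by blast
    have "X = V"
    proof (rule ccontr)
      assume "X \<noteq> V"
      moreover have "X \<subseteq> V" by (auto simp: X_def)
      ultimately have "X \<noteq> {}" "X \<subset> V" using \<open>x \<in> X\<close> by blast+
      then obtain e where e: "e \<in> H" "d e \<inter> X \<noteq> {}" "\<not> d e \<subseteq> X"
        using cut_connectedD[OF H(2)] by metis
      have eE: "e \<in> E" using e H(1) by blast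
      obtain a b where ab: "d e = {a, b}" "a \<noteq> b" using ends_card[OF eE] by (auto simp: card_2_iff)
      then obtain p q where pq: "d e = {p, q}" "p \<noteq> q" "p \<in> X" "q \<notin> X" using e by auto
      then have "q \<in> V" using ends_sub[OF eE] by auto
      obtain J where J: "J \<subseteq> H" "\<forall>v\<in>V. odd (deg d J v) \<longleftrightarrow> (v = x) \<noteq> (v = p)"
        using pq(3) by (auto simp: X_def)
      have "incident d {e} v = (if v = p \<or> v = q then {e} else {})" for v
        using pq by (auto simp: incident_def)
      then have "odd (deg d {e} v) \<longleftrightarrow> v = p \<or> v = q" for v by simp
      then obtain L where "L \<subseteq> H" "\<forall>v\<in>V. odd (deg d L v) \<longleftrightarrow> ((v = x) \<noteq> (v = p)) \<noteq> (v = p \<or> v = q)"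
        using sum[of J "{e}"] J e(1) by auto
      then have "q \<in> X" using \<open>q \<in> V\<close> pq(2) by (auto simp: X_def)
      then show False using pq by blast
    qed
    then show ?thesis using y by (auto simp: X_def)
  qed
  have "finite T" using T(1) by (rule fin_vsub)
  then show ?thesis
    using T
  proof (induction "card T" arbitrary: T rule: less_induct)
    case less
    show ?case
    proof (cases "T = {}")
      case True
      then show ?thesis by (auto simp: incident_def intro!: exI[of _ "{}"])
    next
      case False
      then obtain x where x: "x \<in> T" by blast
      have "T \<noteq> {x}" using less.prems by auto
      then obtain y where y: "y \<in> T" "y \<noteq> x" using x by blast
      have "card (T - {x, y}) = card T - 2"
        using x y less.prems by (subst card_Diff_subset) auto
      moreover have "card T > 0" using x less.prems by (auto simp: card_gt_0_iff)
      ultimately obtain J where J: "J \<subseteq> H" "\<forall>v\<in>V. odd (deg d J v) \<longleftrightarrow> v \<in> T - {x, y}"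
        using less.hyps[of "T - {x, y}"] less.prems by auto
      obtain K where K: "K \<subseteq> H" "\<forall>v\<in>V. odd (deg d K v) \<longleftrightarrow> (v = x) \<noteq> (v = y)"
        using pair[of x y] x y(1) less.prems(2) by auto
      obtain L where L: "L \<subseteq> H" "\<forall>v\<in>V. odd (deg d L v) \<longleftrightarrow> odd (deg d J v) \<noteq> odd (deg d K v)"
        using sum[OF J(1) K(1)] by blast
      have "\<forall>v\<in>V. odd (deg d L v) \<longleftrightarrow> v \<in> T"
      proof
        fix v assume "v \<in> V"
        then have "odd (deg d L v) \<longleftrightarrow> (v \<in> T - {x, y}) \<noteq> ((v = x) \<noteq> (v = y))"
          using J(2) K(2) L(2) by simp
        then show "odd (deg d L v) \<longleftrightarrow> v \<in> T" using x y by blast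
      qed
      then show ?thesis using L(1) by blast
    qed
  qed
qed

lemma even_card_odd_deg:
  assumes "F \<subseteq> E" shows "even (card {v \<in> V. odd (deg d F v)})"
  using even_sum_iff[OF finV, of "deg d F"] handshake[OF assms] by simp

end

section \<open>Closed trails\<close>

lemma walk_endpoints: "walk G u p w \<Longrightarrow> u \<in> verts G \<and> w \<in> verts G"
  by (induction G u p w rule: walk.induct) auto

lemma walk_append: "walk G u p v \<Longrightarrow> walk G v q w \<Longrightarrow> walk G u (p @ q) w"
  by (induction G u p v rule: walk.induct) auto

lemma walk_vertices: "walk G u p w \<Longrightarrow> insert u (snd ` set p) \<subseteq> verts G"
  by (induction G u p w rule: walk.induct) auto

lemma walk_edges: "walk G u p w \<Longrightarrow> fst ` set p \<subseteq> edges G"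
  by (induction G u p w rule: walk.induct) auto

lemma walk_edge_ends: "walk G u p w \<Longrightarrow> e \<in> fst ` set p \<Longrightarrow> ends G e \<subseteq> insert u (snd ` set p)"
  by (induction G u p w rule: walk.induct) auto

lemma walk_split:
  "walk G u p w \<Longrightarrow> x \<in> insert u (snd ` set p) \<Longrightarrow> \<exists>p1 p2. p = p1 @ p2 \<and> walk G u p1 x \<and> walk G x p2 w"
proof (induction G u p w rule: walk.induct)
  case (1 G u v)
  then show ?case by auto
next
  case (2 G u e w p v)
  show ?case
  proof (cases "x = u")
    case True
    then show ?thesis using 2 by (intro exI[of _ "[]"] exI[of _ "(e, w) # p"]) auto
  next
    case False
    then have "x \<in> insert w (snd ` set p)" using 2(3) by auto
    moreover have "walk G w p v" using 2(2) by simp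
    ultimately obtain p1 p2 where p12: "p = p1 @ p2" "walk G w p1 x" "walk G x p2 v" using 2(1) by blast
    have "walk G u ((e, w) # p1) x" using 2(2) p12(2) by simp
    moreover have "(e, w) # p = ((e, w) # p1) @ p2" using p12(1) by simp
    ultimately show ?thesis using p12(3) by blast
  qed
qed

text \<open>Without loops, each step meets \<open>v\<close> either where it starts or where it ends,
  not both. The list of starts arises from the list of ends by dropping \<open>w\<close> and adding
  \<open>u\<close>, hence the two correction terms.\<close>

lemma walk_incidence_count:
  assumes "\<And>e. e \<in> edges G \<Longrightarrow> card (ends G e) = 2" "walk G u p w"
  shows "length (filter (\<lambda>e. v \<in> ends G e) (map fst p)) + of_bool (v = w)
    = 2 * count_list (map snd p) v + of_bool (v = u)"
  using assms(2)
proof (induction p arbitrary: u)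
  case Nil
  then show ?case by simp
next
  case (Cons a p)
  obtain e x where a: "a = (e, x)" by (cases a)
  then have e: "e \<in> edges G" "ends G e = {u, x}" "walk G x p w" using Cons.prems by auto
  then have "u \<noteq> x" using assms(1)[of e] by auto
  then show ?case using Cons.IH[OF e(3)] e(2) a by auto
qed

text \<open>Serves both to pass to a larger edge set and to forget which copy of a duplicated edge
  is used.\<close>

lemma walk_map_edges:
  assumes "\<And>e. e \<in> edges G \<Longrightarrow> h e \<in> edges G' \<and> ends G' (h e) = ends G e" "verts G' = verts G"
  shows "walk G u p w \<Longrightarrow> walk G' u (map (\<lambda>(e, v). (h e, v)) p) w"
  by (induction p arbitrary: u) (use assms in auto)

context mgraph
begin

text \<open>A longest trail is closed, by parity at its last vertex. Rotated to start at any of its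
  vertices it still cannot be extended, so it uses all edges at the vertices it visits; by
  connectedness it visits all of \<open>V\<close>.\<close>

lemma eulerian_closed_trail:
  assumes V: "card V > 1" and conn: "cut_connected d V E" and even: "\<And>v. v \<in> V \<Longrightarrow> even (deg d E v)"
  defines "G \<equiv> \<lparr>verts = V, edges = E, ends = d\<rparr>"
  shows "\<exists>u p. closed_trail G u p \<and> spanning G u p \<and> (\<forall>v\<in>V. 2 * visits p v = deg d E v)"
proof -
  have G: "verts G = V" "edges G = E" "ends G = d" by (simp_all add: G_def)
  have count: "deg d (fst ` set p) v + of_bool (v = w) = 2 * visits p v + of_bool (v = u)"
    if p: "walk G u p w" "distinct (map fst p)" for u p w v
  proof -
    have "incident d (fst ` set p) v = set (filter (\<lambda>e. v \<in> d e) (map fst p))"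
      by (auto simp: incident_def)
    then have "deg d (fst ` set p) v = length (filter (\<lambda>e. v \<in> d e) (map fst p))"
      using distinct_card[OF distinct_filter[OF p(2)], of "\<lambda>e. v \<in> d e"] by (simp only:)
    then show ?thesis
      using walk_incidence_count[of G u p w v] p(1) ends_card by (simp add: G visits_def)
  qed
  define P where "P q \<longleftrightarrow> (case q of (u, p, w) \<Rightarrow> walk G u p w \<and> distinct (map fst p))" for q :: "'v \<times> ('e \<times> 'v) list \<times> 'v"
  obtain v0 where v0: "v0 \<in> V" using V by (metis card.empty ex_in_conv not_less_zero)
  have "P (v0, [], v0)" using v0 by (simp add: P_def G)
  moreover have "\<forall>q. P q \<longrightarrow> length (fst (snd q)) < Suc (card E)"
  proof (intro allI impI)
    fix q assume q: "P q"
    obtain u p w where q_eq: "q = (u, p, w)" by (cases q)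
    have "length p = card (fst ` set p)" using q q_eq distinct_card[of "map fst p"] by (simp add: P_def)
    also have "\<dots> \<le> card E" using q q_eq walk_edges[of G u p w] finE by (intro card_mono) (auto simp: P_def G)
    finally show "length (fst (snd q)) < Suc (card E)" using q_eq by simp
  qed
  ultimately obtain q where "P q" and q_max: "\<forall>q'. P q' \<longrightarrow> length (fst (snd q')) \<le> length (fst (snd q))"
    using ex_has_greatest_nat[of P _ "\<lambda>q. length (fst (snd q))"] by blast
  then obtain u p w where q: "q = (u, p, w)" and p: "walk G u p w" "distinct (map fst p)"
    by (cases q) (auto simp: P_def)
  have longest: "length p' \<le> length p" if "walk G u' p' w'" "distinct (map fst p')" for u' p' w'
    using q_max[rule_format, of "(u', p', w')"] that by (simp add: P_def q)
  have pE: "fst ` set p \<subseteq> E" using walk_edges[OF p(1)] by (simp add: G)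
  have extend: False if p': "walk G u' p' w'" "distinct (map fst p')" "length p' = length p"
    and e: "e \<in> E" "e \<notin> fst ` set p'" "w' \<in> d e" for u' p' w' e
  proof -
    obtain a b where "d e = {a, b}" using ends_card[OF e(1)] by (auto simp: card_2_iff)
    then obtain x where x: "d e = {w', x}" using e(3) by auto
    have "w' \<in> V" "x \<in> V" using x ends_sub[OF e(1)] by auto
    then have "walk G w' [(e, x)] x" using e x by (simp add: G)
    then have "walk G u' (p' @ [(e, x)]) x" by (rule walk_append[OF p'(1)])
    then show False using longest[of u' "p' @ [(e, x)]" x] p'(2,3) e(2) by auto
  qed
  have closed: "w = u"
  proof (rule ccontr)
    assume "w \<noteq> u"
    then have "Suc (deg d (fst ` set p) w) = 2 * visits p w" using count[OF p, of w] by simp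
    then have "odd (deg d (fst ` set p) w)" by (metis dvd_triv_left even_Suc)
    moreover have "w \<in> V" using walk_endpoints[OF p(1)] by (simp add: G)
    ultimately have "incident d (fst ` set p) w \<noteq> incident d E w" using even by metis
    then obtain e where "e \<in> E" "w \<in> d e" "e \<notin> fst ` set p" using pE by (auto simp: incident_def)
    then show False using extend[OF p refl] by blast
  qed
  define X where "X = insert u (snd ` set p)"
  have XV: "X \<subseteq> V" using walk_vertices[OF p(1)] by (simp add: X_def G)
  have visited_used: "e \<in> fst ` set p" if e: "e \<in> E" and x: "x \<in> d e" "x \<in> X" for e x
  proof (rule ccontr)
    assume e_new: "e \<notin> fst ` set p"
    obtain p1 p2 where p12: "p = p1 @ p2" "walk G u p1 x" "walk G x p2 u"
      using walk_split[OF p(1), of x] x(2) unfolding closed X_def by blast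
    have "walk G x (p2 @ p1) x" by (rule walk_append[OF p12(3,2)])
    then show False
      using extend[of x "p2 @ p1" x e] p(2) p12(1) e x e_new by auto
  qed
  have "X = V"
  proof (rule ccontr)
    assume "X \<noteq> V"
    then have "X \<noteq> {}" "X \<subset> V" using XV by (auto simp: X_def)
    then obtain e where e: "e \<in> E" "d e \<inter> X \<noteq> {}" "\<not> d e \<subseteq> X"
      using cut_connectedD[OF conn] by metis
    then have "e \<in> fst ` set p" using visited_used by blast
    then show False using walk_edge_ends[OF p(1)] e(3) by (simp add: G X_def)
  qed
  have "fst ` set p = E"
  proof
    show "E \<subseteq> fst ` set p"
      using visited_used \<open>X = V\<close> ends_sub ends_nonempty by blast
  qed (rule pE)
  then have "\<forall>v\<in>V. 2 * visits p v = deg d E v" using count[OF p] closed by simp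
  moreover have "spanning G u p" using \<open>X = V\<close> by (auto simp: spanning_def X_def G)
  ultimately show ?thesis using p closed by (auto simp: closed_trail_def closed_walk_def)
qed

text \<open>The inequality is \<open>visits p v < (deg d E v + k/2 - 4) / k + 2\<close> multiplied
  by \<open>2 * k\<close>. The trail passes through \<open>v\<close> half as often as its degree in
  an Eulerian subgraph of \<open>H\<close>.\<close>

lemma spanning_closed_trail:
  assumes V: "card V > 1" and k: "4 \<le> k"
    and cut: "\<And>X. X \<noteq> {} \<Longrightarrow> X \<subset> V \<Longrightarrow> k \<le> card (boundary d E X)"
  defines "G \<equiv> \<lparr>verts = V, edges = E, ends = d\<rparr>"
  shows "\<exists>u p. closed_trail G u p \<and> spanning G u p \<and> (\<forall>v\<in>V. 2 * k * visits p v + 8 < 2 * deg d E v + 5 * k)"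
proof -
  have ne: "V \<noteq> {}" using V by auto
  have "2 * 2 \<le> k" using k by simp
  then obtain H where H: "H \<subseteq> E" "sparse d 2 V H" "tight d 2 H V"
    and deg_H: "\<forall>v\<in>V. k * deg d H v + 2 * 2 * 2 < 2 * deg d E v + 2 * k * 2 + k"
    using tight_sparse_bounded_degree[OF ne _ _ cut, of 2] by auto
  have mgF: "mgraph V F d" if "F \<subseteq> E" for F
    using that finV fin_sub ends_sub ends_card by unfold_locales blast+
  obtain A B where AB: "A \<subseteq> H" "B \<subseteq> H" "A \<inter> B = {}" "cut_connected d V A" "cut_connected d V B"
    using two_disjoint_connected[OF mgF[OF H(1)] ne H(2,3)] by blast
  have AE: "A \<subseteq> E" and BE: "B \<subseteq> E" using AB H by auto
  obtain J where J: "J \<subseteq> B" "\<forall>v\<in>V. odd (deg d J v) \<longleftrightarrow> v \<in> {v \<in> V. odd (deg d A v)}"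
    using T_join[OF BE AB(5) _ even_card_odd_deg[OF AE]] by auto
  \<comment> \<open>\<open>F\<close> inherits connectedness from \<open>A\<close>, while the join,
    disjoint from \<open>A\<close>, corrects the parity of its degrees.\<close>
  define F where "F = A \<union> J"
  have FH: "F \<subseteq> H" using AB J by (auto simp: F_def)
  then have FE: "F \<subseteq> E" using H by auto
  have fin: "finite (incident d K v)" if "K \<subseteq> E" for K v using fin_sub[OF that] by (simp add: incident_def)
  have even: "even (deg d F v)" if "v \<in> V" for v
  proof -
    have "incident d F v = incident d A v \<union> incident d J v" by (auto simp: F_def incident_def)
    moreover have "incident d A v \<inter> incident d J v = {}" using AB(3) J(1) by (auto simp: incident_def)
    moreover have "J \<subseteq> E" using J BE by auto
    ultimately have "deg d F v = deg d A v + deg d J v" using fin AE by (simp add: card_Un_disjoint)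
    then show ?thesis using J(2) that by simp
  qed
  have "cut_connected d V F" using cut_connected_mono[OF AB(4)] by (simp add: F_def)
  then obtain u p where p: "closed_trail \<lparr>verts = V, edges = F, ends = d\<rparr> u p"
    "spanning \<lparr>verts = V, edges = F, ends = d\<rparr> u p" "\<forall>v\<in>V. 2 * visits p v = deg d F v"
    using mgraph.eulerian_closed_trail[OF mgF[OF FE] V _ even] by blast
  have "walk G u (map (\<lambda>(e, v). (id e, v)) p) u"
    by (rule walk_map_edges[of "\<lparr>verts = V, edges = F, ends = d\<rparr>"])
      (use FE p(1) in \<open>auto simp: G_def closed_trail_def closed_walk_def\<close>)
  then have "closed_trail G u p" using p(1) by (simp add: closed_trail_def closed_walk_def)
  moreover have "spanning G u p" using p(2) by (simp add: spanning_def G_def)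
  moreover have "2 * k * visits p v + 8 < 2 * deg d E v + 5 * k" if v: "v \<in> V" for v
  proof -
    have "deg d F v \<le> deg d H v"
      using FH by (intro card_mono[OF fin[OF H(1)]]) (auto simp: incident_def)
    then have "2 * visits p v \<le> deg d H v" using p(3) v by simp
    then have "k * (2 * visits p v) \<le> k * deg d H v" by (rule mult_le_mono2)
    moreover have "k * (2 * visits p v) = 2 * k * visits p v" "2 * k * 2 + k = 5 * k" by simp_all
    ultimately show ?thesis using bspec[OF deg_H v] by linarith
  qed
  ultimately show ?thesis by blast
qed

end

section \<open>Closed walks and the theorem\<close>

text \<open>The tag \<open>True\<close> marks the second copy of an edge of \<open>J\<close>; copies
  have the ends given by \<open>d \<circ> fst\<close>.\<close>

definition duplicate :: "'e set \<Rightarrow> 'e set \<Rightarrow> ('e \<times> bool) set" where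
  "duplicate E J = E \<times> {False} \<union> J \<times> {True}"

lemma card_duplicate:
  assumes "finite A" "finite B" shows "card (duplicate A B) = card A + card B"
proof -
  have "A \<times> {False} \<inter> B \<times> {True} = {}" by auto
  then show ?thesis unfolding duplicate_def using assms by (simp add: card_Un_disjoint card_cartesian_product)
qed

context mgraph
begin

context
  fixes J assumes J: "J \<subseteq> E"
begin

lemma mgraph_duplicate: "mgraph V (duplicate E J) (d \<circ> fst)"
proof
  show "finite (duplicate E J)" using finE fin_sub[OF J] by (simp add: duplicate_def)
  show "(d \<circ> fst) e \<subseteq> V" "card ((d \<circ> fst) e) = 2" if "e \<in> duplicate E J" for e
  proof -
    have "fst e \<in> E" using that J by (auto simp: duplicate_def)
    then show "(d \<circ> fst) e \<subseteq> V" "card ((d \<circ> fst) e) = 2" using ends_sub ends_card by simp_all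
  qed
qed (rule finV)

lemma deg_duplicate: "deg (d \<circ> fst) (duplicate E J) v = deg d E v + deg d J v"
proof -
  have "incident (d \<circ> fst) (duplicate E J) v = duplicate (incident d E v) (incident d J v)"
    by (auto simp: incident_def duplicate_def)
  moreover have "finite (incident d E v)" "finite (incident d J v)"
    using finE fin_sub[OF J] by (simp_all add: incident_def)
  ultimately show ?thesis by (simp add: card_duplicate)
qed

lemma card_boundary_duplicate:
  "card (boundary (d \<circ> fst) (duplicate E J) X) = card (boundary d E X) + card (boundary d J X)"
proof -
  have "boundary (d \<circ> fst) (duplicate E J) X = duplicate (boundary d E X) (boundary d J X)"
    by (auto simp: boundary_def duplicate_def)
  moreover have "finite (boundary d E X)" "finite (boundary d J X)"
    using finE fin_sub[OF J] by (simp_all add: boundary_def)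
  ultimately show ?thesis by (simp add: card_duplicate)
qed

text \<open>Forgetting the tags leaves the vertex sequence unchanged, but edges of \<open>J\<close>
  may now occur twice, so a trail yields only a walk.\<close>

lemma closed_walk_of_duplicate:
  assumes p: "closed_walk \<lparr>verts = V, edges = duplicate E J, ends = d \<circ> fst\<rparr> u p"
    and sp: "spanning \<lparr>verts = V, edges = duplicate E J, ends = d \<circ> fst\<rparr> u p"
  shows "\<exists>p'. closed_walk \<lparr>verts = V, edges = E, ends = d\<rparr> u p' \<and>
    spanning \<lparr>verts = V, edges = E, ends = d\<rparr> u p' \<and> visits p' = visits p"
proof -
  define p' where "p' = map (\<lambda>(e, v). (fst e, v)) p"
  have snd_p': "map snd p' = map snd p" by (simp add: p'_def case_prod_beta comp_def)
  have "closed_walk \<lparr>verts = V, edges = E, ends = d\<rparr> u p'"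
    unfolding p'_def closed_walk_def
    by (rule walk_map_edges[of "\<lparr>verts = V, edges = duplicate E J, ends = d \<circ> fst\<rparr>"])
      (use J p in \<open>auto simp: duplicate_def closed_walk_def\<close>)
  moreover have "spanning \<lparr>verts = V, edges = E, ends = d\<rparr> u p'"
    using sp unfolding spanning_def snd_p' by simp
  moreover have "visits p' = visits p" unfolding visits_def snd_p' ..
  ultimately show ?thesis by blast
qed

text \<open>The hypothesis makes all cuts of the duplicated graph have at least four edges, so the
  closed trail for \<open>k = 4\<close> exists there.\<close>

lemma closed_walk_of_duplicate_4:
  assumes V: "card V > 1"
    and cut: "\<And>X. X \<noteq> {} \<Longrightarrow> X \<subset> V \<Longrightarrow> 4 \<le> card (boundary d E X) + card (boundary d J X)"
  shows "\<exists>u p. closed_walk \<lparr>verts = V, edges = E, ends = d\<rparr> u p \<and>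
    spanning \<lparr>verts = V, edges = E, ends = d\<rparr> u p \<and>
    (\<forall>v\<in>V. 4 * visits p v < deg d E v + deg d J v + 6)"
proof -
  let ?Q = "\<lparr>verts = V, edges = duplicate E J, ends = d \<circ> fst\<rparr>"
  have "\<exists>u p. closed_trail ?Q u p \<and> spanning ?Q u p \<and>
      (\<forall>v\<in>V. 2 * 4 * visits p v + 8 < 2 * deg (d \<circ> fst) (duplicate E J) v + 5 * 4)"
    by (rule mgraph.spanning_closed_trail[OF mgraph_duplicate V]) (simp_all add: card_boundary_duplicate cut)
  then obtain u p where p: "closed_walk ?Q u p" "spanning ?Q u p"
    and vis: "\<forall>v\<in>V. 2 * 4 * visits p v + 8 < 2 * deg (d \<circ> fst) (duplicate E J) v + 5 * 4"
    unfolding closed_trail_def by blast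
  obtain p' where p': "closed_walk \<lparr>verts = V, edges = E, ends = d\<rparr> u p'"
    "spanning \<lparr>verts = V, edges = E, ends = d\<rparr> u p'" "visits p' = visits p"
    using closed_walk_of_duplicate[OF p] by blast
  have "4 * visits p' v < deg d E v + deg d J v + 6" if "v \<in> V" for v
    using bspec[OF vis that] by (simp add: deg_duplicate p'(3))
  then show ?thesis using p' by blast
qed

end

text \<open>The doubled graph is Eulerian with degrees \<open>2 * deg d E v\<close>, and for
  \<open>k = 1\<close> the required bound is \<open>deg d E v\<close> itself.\<close>

lemma spanning_closed_walk_1:
  assumes V: "card V > 1" and conn: "\<And>X. X \<noteq> {} \<Longrightarrow> X \<subset> V \<Longrightarrow> 1 \<le> card (boundary d E X)"
  shows "\<exists>u p. closed_walk \<lparr>verts = V, edges = E, ends = d\<rparr> u p \<and>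
    spanning \<lparr>verts = V, edges = E, ends = d\<rparr> u p \<and> (\<forall>v\<in>V. visits p v = deg d E v)"
proof -
  let ?Q = "\<lparr>verts = V, edges = duplicate E E, ends = d \<circ> fst\<rparr>"
  have "boundary (d \<circ> fst) (duplicate E E) X \<noteq> {}" if "X \<noteq> {}" "X \<subset> V" for X
  proof
    assume "boundary (d \<circ> fst) (duplicate E E) X = {}"
    then have "card (boundary d E X) = 0" using card_boundary_duplicate[OF order_refl, of X] by simp
    then show False using conn[OF that] by simp
  qed
  then have "cut_connected (d \<circ> fst) V (duplicate E E)" by (simp add: cut_connected_def)
  then obtain u p where p: "closed_walk ?Q u p" "spanning ?Q u p"
    "\<forall>v\<in>V. 2 * visits p v = deg (d \<circ> fst) (duplicate E E) v"
    using mgraph.eulerian_closed_trail[OF mgraph_duplicate[OF order_refl] V]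
    unfolding deg_duplicate[OF order_refl] closed_trail_def by auto
  then show ?thesis
    using closed_walk_of_duplicate[OF order_refl p(1,2)] unfolding deg_duplicate[OF order_refl] by fastforce
qed

text \<open>Doubling every edge doubles the cuts to at least four edges; the bound
  \<open>4 * visits p v < 2 * deg d E v + 6\<close> is then halved.\<close>

lemma spanning_closed_walk_2:
  assumes V: "card V > 1" and cut: "\<And>X. X \<noteq> {} \<Longrightarrow> X \<subset> V \<Longrightarrow> 2 \<le> card (boundary d E X)"
  shows "\<exists>u p. closed_walk \<lparr>verts = V, edges = E, ends = d\<rparr> u p \<and>
    spanning \<lparr>verts = V, edges = E, ends = d\<rparr> u p \<and> (\<forall>v\<in>V. 2 * visits p v \<le> deg d E v + 2)"
proof -
  have "4 \<le> card (boundary d E X) + card (boundary d E X)" if "X \<noteq> {}" "X \<subset> V" for X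
    using cut[OF that] by linarith
  then obtain u p where p: "closed_walk \<lparr>verts = V, edges = E, ends = d\<rparr> u p"
    "spanning \<lparr>verts = V, edges = E, ends = d\<rparr> u p"
    "\<forall>v\<in>V. 4 * visits p v < deg d E v + deg d E v + 6"
    using closed_walk_of_duplicate_4[OF order_refl V] by blast
  have "2 * visits p v \<le> deg d E v + 2" if "v \<in> V" for v using bspec[OF p(3) that] by linarith
  then show ?thesis using p by blast
qed

text \<open>Doubling the edges of a \<open>T\<close>-join for the set \<open>T\<close> of vertices of odd degree makes all degrees, hence all
  cuts, even. So the graph becomes 4-edge-connected. If the \<open>T\<close>-join lies in a spanning tree with small degrees, then
  the degrees do not grow too much.\<close>

lemma spanning_closed_walk_3:
  assumes V: "card V > 1" and cut: "\<And>X. X \<noteq> {} \<Longrightarrow> X \<subset> V \<Longrightarrow> 3 \<le> card (boundary d E X)"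
  shows "\<exists>u p. closed_walk \<lparr>verts = V, edges = E, ends = d\<rparr> u p \<and>
    spanning \<lparr>verts = V, edges = E, ends = d\<rparr> u p \<and> (\<forall>v\<in>V. 3 * visits p v \<le> deg d E v + 4)"
proof -
  have ne: "V \<noteq> {}" using V by auto
  obtain H where H: "H \<subseteq> E" "sparse d 1 V H" "tight d 1 H V"
    and deg_H: "\<forall>v\<in>V. 3 * deg d H v + 2 * 1 * 1 < 1 * deg d E v + 2 * 3 * 1 + 3"
    using tight_sparse_bounded_degree[OF ne _ _ cut, of 1] by auto
  obtain J where J: "J \<subseteq> H" "\<forall>v\<in>V. odd (deg d J v) \<longleftrightarrow> v \<in> {v \<in> V. odd (deg d E v)}"
    using T_join[OF H(1) tight_imp_cut_connected[OF H] _ even_card_odd_deg[OF order_refl]] by auto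
  have JE: "J \<subseteq> E" using J(1) H(1) by blast
  interpret Q: mgraph V "duplicate E J" "d \<circ> fst" by (rule mgraph_duplicate[OF JE])
  have even_deg: "even (deg d E v + deg d J v)" if "v \<in> V" for v using J(2) that by simp
  have "4 \<le> card (boundary d E X) + card (boundary d J X)" if X: "X \<noteq> {}" "X \<subset> V" for X
  proof -
    \<comment> \<open>The degree sum over \<open>X\<close> and the size of its cut differ by twice
      the number of inner edges, so the cut is even and at least 3.\<close>
    have "even (\<Sum>v\<in>X. deg d E v + deg d J v)" using X(2) even_deg by (intro dvd_sum) blast
    then have "even (card (boundary d E X) + card (boundary d J X))"
      using Q.sum_deg[OF order_refl, of X] X(2)
      unfolding deg_duplicate[OF JE] card_boundary_duplicate[OF JE] by auto
    moreover have "3 \<le> card (boundary d E X)" by (rule cut[OF X])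
    moreover have "4 \<le> n" if "even n" "3 \<le> n" for n :: nat using that by presburger
    ultimately show ?thesis by (metis trans_le_add1)
  qed
  then obtain u p where p: "closed_walk \<lparr>verts = V, edges = E, ends = d\<rparr> u p"
    "spanning \<lparr>verts = V, edges = E, ends = d\<rparr> u p"
    "\<forall>v\<in>V. 4 * visits p v < deg d E v + deg d J v + 6"
    using closed_walk_of_duplicate_4[OF JE V] by blast
  have "3 * visits p v \<le> deg d E v + 4" if v: "v \<in> V" for v
  proof -
    have "deg d J v \<le> deg d H v"
      using J(1) fin_sub[OF H(1)] by (intro card_mono) (auto simp: incident_def)
    then have "3 * deg d J v \<le> deg d E v + 6" using bspec[OF deg_H v] by linarith
    \<comment> \<open>Parity sharpens the first premise to \<open>4 * x \<le> a + j + 4\<close>; the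
      rest is integer rounding.\<close>
    moreover have "3 * x \<le> a + 4" if "4 * x < a + j + 6" "3 * j \<le> a + 6" "even (a + j)" for x a j :: nat
      using that by presburger
    ultimately show ?thesis using bspec[OF p(3) v] even_deg[OF v] by blast
  qed
  then show ?thesis using p by blast
qed

end

text \<open>The integer \<open>n - 2\<close> lies strictly below \<open>\<lceil>x\<rceil>\<close>.
  Thus both bounds of the theorem can be handled as strict inequalities without rounding.\<close>

lemma le_ceiling_add_one:
  fixes x :: real
  assumes "real n < x + 2"
  shows "int n \<le> \<lceil>x\<rceil> + 1"
  using assms by linarith

text \<open>A boundary of fewer than \<open>k\<close> edges could be deleted without disconnecting
  \<open>G\<close>, but a walk avoiding it never leaves \<open>X\<close>.\<close>

lemma edge_connected_cut:
  assumes fin: "finite_multigraph G" and conn: "edge_connected k G" and X: "X \<noteq> {}" "X \<subset> verts G"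
  shows "k \<le> card (boundary (ends G) (edges G) X)"
proof (rule ccontr)
  define F where "F = boundary (ends G) (edges G) X"
  assume "\<not> ?thesis"
  moreover have "F \<subseteq> edges G" by (auto simp: F_def boundary_def)
  ultimately have "connected_graph (delete_edges G F)" using conn by (simp add: edge_connected_def F_def)
  moreover obtain x y where xy: "x \<in> X" "y \<in> verts G - X" using X by blast
  ultimately obtain p where "walk (delete_edges G F) x p y"
    using X(2) unfolding connected_graph_def delete_edges_def by fastforce
  then have "y \<in> X" using xy(1)
  proof (induction p arbitrary: x)
    case (Cons a p)
    obtain e z where a: "a = (e, z)" by (cases a)
    then have e: "e \<in> edges G" "e \<notin> F" "ends G e = {x, z}" "walk (delete_edges G F) z p y"
      using Cons.prems by (auto simp: delete_edges_def)
    then have "z \<in> X" using Cons.prems(2) by (auto simp: F_def boundary_def)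
    then show ?case using Cons.IH e(4) by blast
  qed simp
  then show False using xy by blast
qed

theorem theorem7p8:
  fixes k :: nat and G :: "('v, 'e) multigraph"
  assumes "k \<ge> 1"
    and "finite_multigraph G"
    and "edge_connected k G"
  shows "(k \<ge> 4 \<longrightarrow>
            (\<exists>u p. closed_trail G u p \<and> spanning G u p \<and>
               (\<forall>v\<in>verts G. int (visits p v) \<le>
                  \<lceil>(real (degree G v) + real k / 2 - 4) / real k\<rceil> + 1))) \<and>
         (k \<le> 3 \<longrightarrow>
            (\<exists>u p. closed_walk G u p \<and> spanning G u p \<and>
               (\<forall>v\<in>verts G. int (visits p v) \<le>
                  \<lceil>(real (degree G v) - 1) / real k\<rceil> + 1)))"
proof -
  interpret mgraph "verts G" "edges G" "ends G"
    using assms(2) by unfold_locales (auto simp: finite_multigraph_def)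
  have G: "\<lparr>verts = verts G, edges = edges G, ends = ends G\<rparr> = G" by simp
  have deg: "deg (ends G) (edges G) v = degree G v" for v by (simp add: incident_def degree_def)
  have V: "card (verts G) > 1" using assms(3) by (simp add: edge_connected_def)
  note cut = edge_connected_cut[OF assms(2,3)]
  have k0: "real k > 0" using assms(1) by simp
  show ?thesis
  proof (intro conjI impI)
    assume "k \<ge> 4"
    then obtain u p where p: "closed_trail G u p" "spanning G u p"
      and vis: "\<forall>v\<in>verts G. 2 * k * visits p v + 8 < 2 * degree G v + 5 * k"
      using spanning_closed_trail[OF V _ cut, unfolded G deg] by blast
    have "int (visits p v) \<le> \<lceil>(real (degree G v) + real k / 2 - 4) / real k\<rceil> + 1" if "v \<in> verts G" for v
    proof (rule le_ceiling_add_one)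
      have "real (2 * k * visits p v + 8) < real (2 * degree G v + 5 * k)"
        using bspec[OF vis that] by (rule of_nat_less_iff[THEN iffD2])
      then show "real (visits p v) < (real (degree G v) + real k / 2 - 4) / real k + 2"
        using k0 by (simp add: field_simps)
    qed
    then show "\<exists>u p. closed_trail G u p \<and> spanning G u p \<and>
        (\<forall>v\<in>verts G. int (visits p v) \<le> \<lceil>(real (degree G v) + real k / 2 - 4) / real k\<rceil> + 1)"
      using p by blast
  next
    assume "k \<le> 3"
    \<comment> \<open>The common form of the three cases:
      \<open>visits p v < (degree G v - 1) / k + 2\<close> multiplied by \<open>k\<close>. The
      subtraction is not truncated as \<open>k \<ge> 1\<close>.\<close>
    have "\<exists>u p. closed_walk G u p \<and> spanning G u p \<and>
        (\<forall>v\<in>verts G. k * visits p v < degree G v + 2 * k - 1)"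
    proof -
      consider "k = 1" | "k = 2" | "k = 3" using assms(1) \<open>k \<le> 3\<close> by linarith
      then show ?thesis
      proof cases
        case 1
        show ?thesis
          using spanning_closed_walk_1[OF V, unfolded G deg] cut unfolding 1 by fastforce
      next
        case 2
        show ?thesis
          using spanning_closed_walk_2[OF V, unfolded G deg] cut unfolding 2 by fastforce
      next
        case 3
        show ?thesis
          using spanning_closed_walk_3[OF V, unfolded G deg] cut unfolding 3 by fastforce
      qed
    qed
    then obtain u p where p: "closed_walk G u p" "spanning G u p"
      and vis: "\<forall>v\<in>verts G. k * visits p v < degree G v + 2 * k - 1" by blast
    have "int (visits p v) \<le> \<lceil>(real (degree G v) - 1) / real k\<rceil> + 1" if "v \<in> verts G" for v
    proof (rule le_ceiling_add_one)
      have "k * visits p v + 1 < degree G v + 2 * k" using bspec[OF vis that] by linarith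
      then have "real (k * visits p v + 1) < real (degree G v + 2 * k)" by (rule of_nat_less_iff[THEN iffD2])
      then show "real (visits p v) < (real (degree G v) - 1) / real k + 2"
        using k0 by (simp add: field_simps)
    qed
    then show "\<exists>u p. closed_walk G u p \<and> spanning G u p \<and>
        (\<forall>v\<in>verts G. int (visits p v) \<le> \<lceil>(real (degree G v) - 1) / real k\<rceil> + 1)"
      using p by blast
  qed
qed

end
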